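(* Let $d\geq2$ be an integer. (a) Let $b\in\big(0,\frac{d-1}{d+1}\big]$ be rational. Then $\mathbb{S}_{\mathbb{Q}}(d,b)=\mathbb{S}_{\mathbb{Q}}\setminus\{\pm1\}$. (b) Let $b\in\big(\frac{d-1}{d+1},1\big)$ be rational. Then $\mathbb{S}_{\mathbb{Q}}(d,b)$ is dense in $\mathbb{S}\setminus I(\theta_b)$.
   Context: $\mathbb{S}$ is the unit circle in $\mathbb{C}$ and $\mathbb{S}_{\mathbb{Q}}$ is the set of points of $\mathbb{S}$ with rational real and imaginary parts. For a finite graph $G=(V,E)$, $Z_G(\lambda,b)=\sum_{\sigma:V\to\{+,-\}}\lambda^{|n_+(\sigma)|}b^{\delta(\sigma)}$, where $n_+(\sigma)$ is the set of vertices with spin $+$ and $\delta(\sigma)$ is the number of edges whose endpoints get different spins; for a vertex $u$, $Z_{G,+u}(\lambda,b)$ and $Z_{G,-u}(\lambda,b)$ denote the same sum restricted to $\sigma$ with $\sigma(u)=+$, respectively $\sigma(u)=-$. A tree $T$ rooted at $r$ implements the field $\lambda'$ (with respect to $\lambda,b$) if $Z_{T,-r}(\lambda,b)\neq0$ and $\lambda'=Z_{T,+r}(\lambda,b)/Z_{T,-r}(\lambda,b)$. $\mathcal{T}_{d+1}$ is the set of all rooted trees of maximum degree at most $d+1$ whose root has degree at most $d$. For $b\in(0,1)$ and $d\geq2$, $\mathbb{S}_{\mathbb{Q}}(d,b)$ is the set of $\lambda\in\mathbb{S}_{\mathbb{Q}}$ for which the set of fields implemented (with respect to $\lambda,b$)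 by trees in $\mathcal{T}_{d+1}$ whose root has degree $1$ is dense in $\mathbb{S}$. For $\theta\in(0,\pi)$, $I(\theta)=\{e^{i\vartheta}: -\theta<\vartheta<\theta\}$. With $\Delta=d+1$ and $b\in(\frac{\Delta-2}{\Delta},1)=(\frac{d-1}{d+1},1)$, $\theta_b\in(0,\pi)$ is the (unique) angle, known to exist by a theorem of Peters and Regts, such that (i) $Z_G(\lambda,b)\neq0$ for every graph $G$ of maximum degree at most $\Delta$ and every $\lambda\in I(\theta_b)$; and (ii) for each $\lambda\in\mathbb{S}\setminus I(\theta_b)$ there exist $\lambda'\in\mathbb{S}$ arbitrarily close to $\lambda$ and a tree $T$ of maximum degree $\Delta$ with $Z_T(\lambda',b)=0$. *)

theory Defs
  imports "HOL-Analysis.Analysis"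
begin

text \<open>A graph is given by a vertex set \<open>V\<close> and a set \<open>E\<close> of two-element subsets of \<open>V\<close>.\<close>

definition simple_graph :: "'a set \<Rightarrow> 'a set set \<Rightarrow> bool" where
  "simple_graph V E \<longleftrightarrow> finite V \<and> (\<forall>e\<in>E. e \<subseteq> V \<and> card e = 2)"

definition degree :: "'a set set \<Rightarrow> 'a \<Rightarrow> nat" where
  "degree E v = card {e \<in> E. v \<in> e}"

text \<open>Inserting \<open>0\<close> only matters for the graph without vertices.\<close>

definition max_degree :: "'a set \<Rightarrow> 'a set set \<Rightarrow> nat" where
  "max_degree V E = Max (insert 0 (degree E ` V))"

definition adjacency :: "'a set set \<Rightarrow> ('a \<times> 'a) set" where
  "adjacency E = {(u, v). {u, v} \<in> E}"

definition connected_graph :: "'a set \<Rightarrow> 'a set set \<Rightarrow> bool" where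
  "connected_graph V E \<longleftrightarrow> V \<noteq> {} \<and> (\<forall>u\<in>V. \<forall>v\<in>V. (u, v) \<in> (adjacency E)\<^sup>*)"

definition is_cycle :: "'a set set \<Rightarrow> 'a list \<Rightarrow> bool" where
  "is_cycle E xs \<longleftrightarrow> length xs \<ge> 3 \<and> distinct xs \<and>
     successively (\<lambda>u v. {u, v} \<in> E) xs \<and> {last xs, hd xs} \<in> E"

definition tree :: "'a set \<Rightarrow> 'a set set \<Rightarrow> bool" where
  "tree V E \<longleftrightarrow> simple_graph V E \<and> connected_graph V E \<and> (\<nexists>xs. is_cycle E xs)"

datatype spin = Plus | Minus

text \<open>Spin configurations are extensional functions on \<open>V\<close>, so that each map
  from \<open>V\<close> to the spins is counted exactly once.\<close>

definition configs :: "'a set \<Rightarrow> ('a \<Rightarrow> spin) set" where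
  "configs V = V \<rightarrow>\<^sub>E {Plus, Minus}"

definition n_plus :: "'a set \<Rightarrow> ('a \<Rightarrow> spin) \<Rightarrow> nat" where
  "n_plus V \<sigma> = card {v \<in> V. \<sigma> v = Plus}"

definition cut_size :: "'a set set \<Rightarrow> ('a \<Rightarrow> spin) \<Rightarrow> nat" where
  "cut_size E \<sigma> = card {e \<in> E. \<exists>u v. e = {u, v} \<and> \<sigma> u \<noteq> \<sigma> v}"

definition ising_weight ::
  "'a set \<Rightarrow> 'a set set \<Rightarrow> complex \<Rightarrow> real \<Rightarrow> ('a \<Rightarrow> spin) \<Rightarrow> complex" where
  "ising_weight V E lam b \<sigma> = lam ^ n_plus V \<sigma> * of_real b ^ cut_size E \<sigma>"

definition Z :: "'a set \<Rightarrow> 'a set set \<Rightarrow> complex \<Rightarrow> real \<Rightarrow> complex" where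
  "Z V E lam b = (\<Sum>\<sigma>\<in>configs V. ising_weight V E lam b \<sigma>)"

definition Z_at ::
  "'a set \<Rightarrow> 'a set set \<Rightarrow> 'a \<Rightarrow> spin \<Rightarrow> complex \<Rightarrow> real \<Rightarrow> complex" where
  "Z_at V E u s lam b = (\<Sum>\<sigma>\<in>{\<sigma> \<in> configs V. \<sigma> u = s}. ising_weight V E lam b \<sigma>)"

definition implements_field ::
  "'a set \<Rightarrow> 'a set set \<Rightarrow> 'a \<Rightarrow> complex \<Rightarrow> real \<Rightarrow> complex \<Rightarrow> bool" where
  "implements_field V E r lam b \<xi> \<longleftrightarrow>
     Z_at V E r Minus lam b \<noteq> 0 \<and> \<xi> = Z_at V E r Plus lam b / Z_at V E r Minus lam b"

text \<open>The rooted trees of maximum degree at most \<open>d + 1\<close> whose root has degree at most \<open>d\<close>,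
  as triples of vertices, edges and root. Up to isomorphism, every finite graph has its
  vertices in \<open>nat\<close>.\<close>

definition rooted_trees :: "nat \<Rightarrow> (nat set \<times> nat set set \<times> nat) set" where
  "rooted_trees d =
     {(V, E, r). tree V E \<and> r \<in> V \<and> max_degree V E \<le> d + 1 \<and> degree E r \<le> d}"

definition unit_circle :: "complex set" where
  "unit_circle = sphere 0 1"

definition rational_circle :: "complex set" where
  "rational_circle = {z \<in> unit_circle. Re z \<in> \<rat> \<and> Im z \<in> \<rat>}"

definition dense_in :: "'a::topological_space set \<Rightarrow> 'a set \<Rightarrow> bool" where
  "dense_in A X \<longleftrightarrow> A \<subseteq> X \<and> X \<subseteq> closure A"

definition leaf_rooted_fields :: "nat \<Rightarrow> complex \<Rightarrow> real \<Rightarrow> complex set" where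
  "leaf_rooted_fields d lam b =
     {\<xi>. \<exists>V E r. (V, E, r) \<in> rooted_trees d \<and> degree E r = 1 \<and> implements_field V E r lam b \<xi>}"

definition dense_field_params :: "nat \<Rightarrow> real \<Rightarrow> complex set" where
  "dense_field_params d b =
     {lam \<in> rational_circle. dense_in (leaf_rooted_fields d lam b) unit_circle}"

definition circle_arc :: "real \<Rightarrow> complex set" where
  "circle_arc \<theta> = {cis t | t. - \<theta> < t \<and> t < \<theta>}"

text \<open>\<open>lee_yang_angle \<Delta> b \<theta>\<close> states that \<open>\<theta>\<close> is the angle \<open>\<theta>\<^sub>b\<close> for the degree bound \<open>\<Delta>\<close>.
  There is at most one such angle: if \<open>\<theta> < \<theta>'\<close> both qualified, the second clause for \<open>\<theta>\<close> would
  give zeros on \<open>circle_arc \<theta>'\<close>. Its existence for \<open>(\<Delta> - 2) / \<Delta> < b < 1\<close> is a theorem of Peters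
  and Regts, so the angle is characterised by a predicate instead of a description operator.\<close>

definition lee_yang_angle :: "nat \<Rightarrow> real \<Rightarrow> real \<Rightarrow> bool" where
  "lee_yang_angle \<Delta> b \<theta> \<longleftrightarrow>
     0 < \<theta> \<and> \<theta> < pi \<and>
     (\<forall>(V :: nat set) E. \<forall>lam\<in>circle_arc \<theta>.
        simple_graph V E \<and> max_degree V E \<le> \<Delta> \<longrightarrow> Z V E lam b \<noteq> 0) \<and>
     (\<forall>lam\<in>unit_circle - circle_arc \<theta>. \<forall>\<epsilon>>0. \<exists>lam'\<in>unit_circle. dist lam' lam < \<epsilon> \<and>
        (\<exists>(V :: nat set) E. tree V E \<and> max_degree V E = \<Delta> \<and> Z V E lam' b = 0))"

end

theory Submission
  imports Defs
begin

text \<open>On the circle the tree recursion reads \<open>\<xi> = \<lambda> * \<Prod> h (\<xi>\<^sub>i)\<close> with at most \<open>d\<close> factors and the disc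
  automorphism \<open>h z = (z + b) / (1 + b * z)\<close>. If \<open>\<lambda> \<noteq> \<plusminus>1\<close>, the set \<open>F\<close> of implemented fields is infinite,
  hence contains pairs of distinct points at arbitrarily small distance. Brouwer's theorem applied to
  \<open>r * \<lambda> * h z ^ d\<close> as \<open>r\<close> tends to \<open>1\<close> gives a fixed point \<open>p\<close> of \<open>f z = \<lambda> * h z ^ d\<close> that either lies in
  the open disc or lies on the circle and satisfies \<open>\<bar>f' p\<bar> \<le> 1\<close>.

  If \<open>p\<close> lies in the disc, \<open>f\<close> uniformly expands the harmonic measure of the circle seen from \<open>p\<close>. A close
  pair in \<open>F\<close> can therefore be expanded to a macroscopic arc, and since the \<open>d\<close> factors of the product may
  be moved from one end of the pair to the other one at a time, each step divides the gaps, relative to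
  the length of the arc, by nearly \<open>d\<close>. So \<open>F\<close> is dense.

  If \<open>p = cis x\<close> lies on the circle, all fields of trees at \<open>cis t\<close> with \<open>\<bar>t\<bar> \<le> \<bar>Arg \<lambda>\<bar>\<close> stay in the arc of
  angles at most \<open>\<bar>x\<bar>\<close>, and no tree has a zero there. For \<open>b \<le> (d - 1) / (d + 1)\<close> this forces \<open>\<lambda> = 1\<close>; for larger
  \<open>b\<close> it forces \<open>\<bar>Arg \<lambda>\<bar> \<le> \<theta>\<close>. Conversely, on a zero-free arc the continuous angle of a tree field cannot
  reach \<open>\<plusminus>pi\<close>, even after a pendant edge is attached, which keeps the fields away from \<open>-1\<close>.\<close>

subsection \<open>Lifts of disc automorphisms\<close>

definition disc_map :: "complex \<Rightarrow> complex \<Rightarrow> complex" where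
  "disc_map p z = (z - p) / (1 - cnj p * z)"

text \<open>For \<open>norm p < 1\<close> the number \<open>1 - p * cis (- x)\<close> has positive
  real part, so the principal logarithm is smooth there, and the formula lifts the circle map
  \<open>disc_map p\<close> to a smooth map of real angles.\<close>

definition disc_lift :: "complex \<Rightarrow> real \<Rightarrow> real" where
  "disc_lift p x = x + 2 * Im (Ln (1 - p * cis (- x)))"

lemma one_minus_notin_nonpos:
  assumes "norm p < 1"
  shows "1 - p * cis x \<notin> \<real>\<^sub>\<le>\<^sub>0"
proof -
  have "Re (p * cis x) \<le> norm (p * cis x)" by (rule complex_Re_le_cmod)
  also have "\<dots> < 1" using assms by (simp add: norm_mult)
  finally show ?thesis by (auto simp: complex_nonpos_Reals_iff)
qed

text \<open>\<open>w / cnj w\<close> is the square of the unit vector \<open>w / norm w\<close>,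
  whose argument is the imaginary part of the logarithm.\<close>

lemma cis_two_Im_Ln:
  assumes "w \<noteq> 0"
  shows "cis (2 * Im (Ln w)) = w / cnj w"
proof -
  have n: "cmod w \<noteq> 0" using assms by simp
  have 1: "cis (Im (Ln w)) = w / cmod w"
    using assms by (metis Arg_eq_Im_Ln cis_Arg sgn_eq)
  have "cis (2 * Im (Ln w)) = cis (Im (Ln w)) ^ 2"
    by (simp add: power2_eq_square cis_mult)
  also have "\<dots> = w * w / (cmod w) ^ 2"
    unfolding 1 by (simp add: power2_eq_square)
  also have "of_real (cmod w ^ 2) = w * cnj w" 
    using complex_norm_square[of w] by simp
  finally show ?thesis using assms by simp
qed

lemma cis_disc_lift:
  assumes "norm p < 1"
  shows "cis (disc_lift p x) = disc_map p (cis x)"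
proof -
  define w where "w = 1 - p * cis (- x)"
  have w: "w \<noteq> 0" using one_minus_notin_nonpos[OF assms, of "-x"] unfolding w_def
    by auto
  have "cis (disc_lift p x) = cis x * (w / cnj w)"
    using cis_two_Im_Ln[OF w] by (simp add: disc_lift_def w_def cis_mult[symmetric])
  also have "cnj w = 1 - cnj p * cis x" by (simp add: w_def cis_cnj)
  also have "cis x * (w / (1 - cnj p * cis x)) = (cis x - p) / (1 - cnj p * cis x)"
    by (simp add: w_def algebra_simps cis_mult)
  finally show ?thesis by (simp add: disc_map_def)
qed

text \<open>The derivative is the Poisson kernel of \<open>p\<close>. Thus increments of
  \<open>disc_lift p\<close> are, up to the factor \<open>2 * pi\<close>, harmonic measures of arcs
  seen from \<open>p\<close>; this is the length in which the tree recursion will be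
  expanding.\<close>

lemma disc_lift_deriv:
  assumes "norm p < 1"
  shows "(disc_lift p has_real_derivative (1 - (cmod p)\<^sup>2) / (cmod (cis x - p))\<^sup>2) (at x)"
proof -
  define w where "w = 1 - p * cis (- x)"
  have w: "w \<notin> \<real>\<^sub>\<le>\<^sub>0" using one_minus_notin_nonpos[OF assms, of "-x"] by (simp add: w_def)
  then have w0: "w \<noteq> 0" by auto
  have 1: "((\<lambda>x. 1 - p * cis (- x)) has_vector_derivative (\<i> * p * cis (- x))) (at x)"
    unfolding cis_conv_exp
    by (auto intro!: derivative_eq_intros has_vector_derivative_real_field simp: algebra_simps)
  have 2: "((\<lambda>x. Ln (1 - p * cis (- x))) has_vector_derivative (\<i> * p * cis (- x) * inverse w)) (at x)"
    using field_vector_diff_chain_at[OF 1, of Ln "inverse w"] has_field_derivative_Ln[OF w]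
    by (simp add: w_def o_def)
  have 3: "((\<lambda>x. Im (Ln (1 - p * cis (- x)))) has_real_derivative Im (\<i> * p * cis (- x) * inverse w)) (at x)"
    using bounded_linear.has_vector_derivative[OF bounded_linear_Im 2]
    by (simp add: has_real_derivative_iff_has_vector_derivative)
  have 4: "(disc_lift p has_real_derivative 1 + 2 * Im (\<i> * p * cis (- x) * inverse w)) (at x)"
    unfolding disc_lift_def[abs_def] by (rule DERIV_add[OF DERIV_ident DERIV_cmult[OF 3]])
  have "1 + 2 * Im (\<i> * p * cis (- x) * inverse w) = Re (1 + 2 * (p * cis (- x) * inverse w))"
    by (simp add: mult.assoc)
  also have "1 + 2 * (p * cis (- x) * inverse w) = (2 - w) * cnj w / (w * cnj w)"
  proof -
    have "p * cis (- x) = 1 - w" by (simp add: w_def)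
    then show ?thesis using w0 by (simp only:) (simp add: field_simps)
  qed
  also have "Re \<dots> = (1 - (cmod (1 - w))\<^sup>2) / (cmod w)\<^sup>2"
  proof -
    have "Re ((2 - w) * cnj w) = 1 - (cmod (1 - w))\<^sup>2"
      unfolding cmod_power2 by (simp add: power2_eq_square algebra_simps)
    moreover have "w * cnj w = of_real ((cmod w)\<^sup>2)"
      by (simp add: complex_norm_square del: of_real_power)
    ultimately show ?thesis by (simp only: Re_divide_of_real)
  qed
  also have "cmod (1 - w) = cmod p" by (simp add: w_def norm_mult)
  also have "cmod w = cmod (cis x * w)" by (simp add: norm_mult)
  also have "cis x * w = cis x - p" by (simp add: w_def algebra_simps cis_mult)
  finally show ?thesis using 4 by simp
qed

section \<open>The edge map and its lift to angles\<close>

definition field_map :: "real \<Rightarrow> complex \<Rightarrow> complex" where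
  "field_map b z = (z + of_real b) / (1 + of_real b * z)"

text \<open>\<open>field_map b\<close> is \<open>disc_map p\<close> for the real point
  \<open>p = - b\<close>, so \<open>disc_lift\<close> supplies its lift.\<close>

definition field_lift :: "real \<Rightarrow> real \<Rightarrow> real" where
  "field_lift b = disc_lift (- of_real b)"

lemma field_map_denom_nonzero:
  fixes z :: complex
  assumes "0 < b" "b < 1" "norm z \<le> 1"
  shows "1 + of_real b * z \<noteq> 0"
proof
  assume "1 + of_real b * z = 0"
  then have "of_real b * z = -1" by (simp add: add_eq_0_iff)
  then have "b * norm z = 1" using assms(1) by (metis abs_of_pos norm_minus_cancel norm_mult norm_of_real norm_one)
  moreover have "b * norm z \<le> b * 1" using assms by (intro mult_left_mono) auto
  ultimately show False using assms by simp
qed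

text \<open>The Schwarz-Pick identity for the automorphism \<open>field_map b\<close>. Besides the
  invariance of disc and circle it yields the derivative bound at boundary fixed points.\<close>

lemma one_minus_norm_field_map:
  assumes "0 < b" "b < 1" "norm z \<le> 1"
  shows "1 - (norm (field_map b z))\<^sup>2 = (1 - b\<^sup>2) * (1 - (norm z)\<^sup>2) / (norm (1 + of_real b * z))\<^sup>2"
proof -
  have n: "norm (1 + of_real b * z) \<noteq> 0" using field_map_denom_nonzero[OF assms] by simp
  have "(norm (1 + of_real b * z))\<^sup>2 - (norm (z + of_real b))\<^sup>2 = (1 - b\<^sup>2) * (1 - (norm z)\<^sup>2)"
    unfolding cmod_power2 by (simp add: power2_eq_square algebra_simps)
  then show ?thesis using n
    by (simp add: field_map_def norm_divide power_divide diff_divide_eq_iff)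
qed

lemma norm_field_map_circle:
  assumes "0 < b" "b < 1" "norm z = 1"
  shows "norm (field_map b z) = 1"
proof -
  have "(norm (field_map b z))\<^sup>2 = 1"
    using one_minus_norm_field_map[of b z] assms by simp
  then show ?thesis using power2_eq_imp_eq[of "norm (field_map b z)" 1] by simp
qed

lemma norm_field_map_le:
  assumes "0 < b" "b < 1" "norm z \<le> 1"
  shows "norm (field_map b z) \<le> 1"
proof -
  have "0 \<le> 1 - (norm (field_map b z))\<^sup>2"
    unfolding one_minus_norm_field_map[OF assms] using assms
    by (intro divide_nonneg_nonneg mult_nonneg_nonneg) (auto simp: abs_square_le_1)
  then show ?thesis using abs_square_le_1[of "norm (field_map b z)"] by simp
qed

lemma norm_field_map_less:
  assumes "0 < b" "b < 1" "norm z < 1"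
  shows "norm (field_map b z) < 1"
proof -
  have "norm (1 + of_real b * z) > 0" using field_map_denom_nonzero[of b z] assms by simp
  then have "0 < 1 - (norm (field_map b z))\<^sup>2"
    using one_minus_norm_field_map[of b z] assms
    by (auto intro!: divide_pos_pos mult_pos_pos simp: abs_square_less_1)
  then show ?thesis using abs_square_less_1[of "norm (field_map b z)"] by simp
qed

lemma continuous_on_field_map:
  assumes "0 < b" "b < 1"
  shows "continuous_on (cball 0 1) (field_map b)"
  unfolding field_map_def[abs_def] using field_map_denom_nonzero[OF assms]
  by (intro continuous_intros) (auto simp: dist_norm)

lemma cis_field_lift:
  assumes "0 < b" "b < 1"
  shows "cis (field_lift b x) = field_map b (cis x)"
  using cis_disc_lift[of "- of_real b" x] assms
  by (simp add: field_lift_def field_map_def disc_map_def)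

lemma norm_denom_cis: "(norm (1 + of_real b * cis x))\<^sup>2 = 1 + b\<^sup>2 + 2 * b * cos x"
proof -
  have "(norm (1 + of_real b * cis x))\<^sup>2 = ((cos x)\<^sup>2 + (sin x)\<^sup>2) * b\<^sup>2 + 1 + 2 * b * cos x"
    unfolding cmod_power2 by (simp add: power2_eq_square algebra_simps
        del: sin_cos_squared_add sin_cos_squared_add2 sin_cos_squared_add3)
  then show ?thesis by simp
qed

lemma field_lift_denom_pos:
  assumes "0 < b" "b < (1::real)"
  shows "0 < 1 + b\<^sup>2 + 2 * b * cos x"
proof -
  have "2 * b * (- cos x) \<le> 2 * b * 1" using assms cos_ge_minus_one[of x] by (intro mult_left_mono) auto
  moreover have "0 < (1 - b)\<^sup>2" using assms by simp
  ultimately show ?thesis by (simp add: power2_eq_square algebra_simps)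
qed

lemma field_lift_deriv:
  assumes "0 < b" "b < 1"
  shows "(field_lift b has_real_derivative (1 - b\<^sup>2) / (1 + b\<^sup>2 + 2 * b * cos x)) (at x)"
proof -
  have "(cmod (cis x - - of_real b))\<^sup>2 = ((cos x)\<^sup>2 + (sin x)\<^sup>2) + b\<^sup>2 + 2 * b * cos x"
    unfolding cmod_power2 by (simp add: power2_eq_square algebra_simps del: sin_cos_squared_add2)
  then have "(cmod (cis x - - of_real b))\<^sup>2 = 1 + b\<^sup>2 + 2 * b * cos x" by simp
  then show ?thesis using disc_lift_deriv[of "- of_real b" x] assms by (simp add: field_lift_def)
qed

lemma field_lift_zero [simp]: "0 < b \<Longrightarrow> field_lift b 0 = 0"
  using Ln_of_real[of "1 + b"] by (simp add: field_lift_def disc_lift_def)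

lemma field_lift_minus:
  assumes "0 < b" "b < 1"
  shows "field_lift b (- x) = - field_lift b x"
proof -
  have "1 - (- of_real b) * cis (- x) \<notin> \<real>\<^sub>\<le>\<^sub>0" using assms by (intro one_minus_notin_nonpos) simp
  then have "Ln (cnj (1 - (- of_real b) * cis (- x))) = cnj (Ln (1 - (- of_real b) * cis (- x)))"
    by (intro cnj_Ln[symmetric])
  then show ?thesis by (simp add: field_lift_def disc_lift_def cis_cnj)
qed

lemma field_lift_mvt:
  assumes "0 < b" "b < 1" "x < y"
  obtains z where "x < z" "z < y"
    "field_lift b y - field_lift b x = (y - x) * ((1 - b\<^sup>2) / (1 + b\<^sup>2 + 2 * b * cos z))"
  using MVT2[OF assms(3), of "field_lift b" "\<lambda>z. (1 - b\<^sup>2) / (1 + b\<^sup>2 + 2 * b * cos z)"]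
    field_lift_deriv[OF assms(1,2)] by blast

lemma divide_le_divideI:
  fixes a c w z :: real
  assumes "a * w \<le> c * z" "0 < z" "0 < w"
  shows "a / z \<le> c / w"
  using assms by (simp add: pos_divide_le_eq pos_le_divide_eq)

text \<open>The extreme slopes occur where the cosine is \<open>1\<close> and \<open>-1\<close>,
  where the denominator is \<open>(1 + b)^2\<close> and \<open>(1 - b)^2\<close>.\<close>

lemma field_lift_slope_bounds:
  assumes "0 < b" "b < (1::real)"
  shows "(1 - b) / (1 + b) \<le> (1 - b\<^sup>2) / (1 + b\<^sup>2 + 2 * b * cos z)"
    and "(1 - b\<^sup>2) / (1 + b\<^sup>2 + 2 * b * cos z) \<le> (1 + b) / (1 - b)"
proof -
  have p: "0 < 1 + b\<^sup>2 + 2 * b * cos z" by (rule field_lift_denom_pos[OF assms])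
  have "b * cos z \<le> b * 1" "b * (-1) \<le> b * cos z" using assms by (intro mult_left_mono; simp)+
  then have le: "1 + b\<^sup>2 + 2 * b * cos z \<le> (1 + b)\<^sup>2" and ge: "(1 - b)\<^sup>2 \<le> 1 + b\<^sup>2 + 2 * b * cos z"
    by (simp_all add: power2_eq_square algebra_simps)
  have "(1 - b) * (1 + b\<^sup>2 + 2 * b * cos z) \<le> (1 - b) * (1 + b)\<^sup>2" using le assms by (intro mult_left_mono) auto
  also have "\<dots> = (1 - b\<^sup>2) * (1 + b)" by (simp add: power2_eq_square algebra_simps)
  finally show "(1 - b) / (1 + b) \<le> (1 - b\<^sup>2) / (1 + b\<^sup>2 + 2 * b * cos z)"
    using p assms by (intro divide_le_divideI) auto
  have "(1 - b\<^sup>2) * (1 - b) = (1 + b) * (1 - b)\<^sup>2" by (simp add: power2_eq_square algebra_simps)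
  also have "\<dots> \<le> (1 + b) * (1 + b\<^sup>2 + 2 * b * cos z)" using ge assms by (intro mult_left_mono) auto
  finally show "(1 - b\<^sup>2) / (1 + b\<^sup>2 + 2 * b * cos z) \<le> (1 + b) / (1 - b)"
    using p assms by (intro divide_le_divideI) auto
qed

lemma field_lift_diff_bounds:
  assumes "0 < b" "b < 1" "x \<le> y"
  shows "(1 - b) / (1 + b) * (y - x) \<le> field_lift b y - field_lift b x"
    and "field_lift b y - field_lift b x \<le> (1 + b) / (1 - b) * (y - x)"
proof -
  have "(1 - b) / (1 + b) * (y - x) \<le> field_lift b y - field_lift b x \<and>
    field_lift b y - field_lift b x \<le> (1 + b) / (1 - b) * (y - x)"
  proof (cases "x < y")
    case True
    then obtain z where z: "field_lift b y - field_lift b x = (y - x) * ((1 - b\<^sup>2) / (1 + b\<^sup>2 + 2 * b * cos z))"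
      using field_lift_mvt[OF assms(1,2)] by blast
    show ?thesis
      unfolding z mult.commute[of "y - x"] using assms
      by (intro conjI mult_right_mono field_lift_slope_bounds) auto
  qed (use assms in simp)
  then show "(1 - b) / (1 + b) * (y - x) \<le> field_lift b y - field_lift b x"
    and "field_lift b y - field_lift b x \<le> (1 + b) / (1 - b) * (y - x)" by auto
qed

lemma field_lift_strict_mono:
  assumes "0 < b" "b < 1" "x < y"
  shows "field_lift b x < field_lift b y"
proof -
  have "0 < (1 - b) / (1 + b) * (y - x)" using assms by simp
  then show ?thesis using field_lift_diff_bounds(1)[OF assms(1,2), of x y] assms by linarith
qed

lemma field_lift_mono:
  assumes "0 < b" "b < 1" "x \<le> y"
  shows "field_lift b x \<le> field_lift b y"
  using field_lift_strict_mono[OF assms(1,2), of x y] assms(3) by (cases "x = y") auto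

text \<open>On so short an interval the slope is nearly constant. The factor \<open>4 / 3\<close> is
  good enough because, divided by \<open>d\<close>, it remains below \<open>1\<close> for every
  \<open>d\<close> from \<open>2\<close> on.\<close>

lemma field_lift_distortion:
  assumes "0 < b" "b < 1" "x \<le> u" "u < v" "v \<le> y" "y - x \<le> (1 - b)\<^sup>2 / 6"
  shows "(field_lift b v - field_lift b u) / (v - u) \<le> 4 / 3 * ((field_lift b y - field_lift b x) / (y - x))"
proof -
  obtain z where z: "u < z" "z < v" 
    "field_lift b v - field_lift b u = (v - u) * ((1 - b\<^sup>2) / (1 + b\<^sup>2 + 2 * b * cos z))"
    using field_lift_mvt[OF assms(1,2,4)] .
  obtain w where w: "x < w" "w < y" 
    "field_lift b y - field_lift b x = (y - x) * ((1 - b\<^sup>2) / (1 + b\<^sup>2 + 2 * b * cos w))"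
    using field_lift_mvt[OF assms(1,2), of x y] assms by auto
  let ?D = "\<lambda>s. 1 + b\<^sup>2 + 2 * b * cos s"
  have p: "0 < ?D s" for s by (rule field_lift_denom_pos[OF assms(1,2)])
  have "\<bar>z - w\<bar> \<le> (1 - b)\<^sup>2 / 6" using z(1,2) w(1,2) assms(3-6) by linarith
  moreover have "\<bar>cos z - cos w\<bar> \<le> \<bar>z - w\<bar>"
  proof -
    have "norm (cos z - cos w) \<le> 1 * norm (z - w)"
      by (rule field_differentiable_bound[of UNIV cos "\<lambda>x. - sin x"])
         (auto intro!: derivative_eq_intros)
    then show ?thesis by simp
  qed
  ultimately have "cos w - cos z \<le> (1 - b)\<^sup>2 / 6" by linarith
  then have "b * (cos w - cos z) \<le> 1 * ((1 - b)\<^sup>2 / 6)" using assms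
    by (intro order.trans[OF mult_left_mono mult_right_mono]) auto
  moreover have "(1 - b)\<^sup>2 \<le> ?D z"
  proof -
    have "b * (-1) \<le> b * cos z" using assms by (intro mult_left_mono) auto
    then show ?thesis by (simp add: power2_eq_square algebra_simps)
  qed
  \<comment> \<open>The two denominators differ by \<open>2 * b * (cos w - cos z)\<close>, which is
    at most \<open>(1 - b)^2 / 3\<close> and so at most a third of \<open>?D z\<close>.\<close>
  ultimately have "?D w \<le> 4 / 3 * ?D z" by (simp add: algebra_simps)
  then have "(1 - b\<^sup>2) * ?D w \<le> (1 - b\<^sup>2) * (4 / 3 * ?D z)"
    using assms by (intro mult_left_mono) (auto simp: abs_square_le_1)
  then have "(1 - b\<^sup>2) / ?D z \<le> 4 / 3 * ((1 - b\<^sup>2) / ?D w)"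
  proof -
    have "(1 - b\<^sup>2) / ?D z \<le> (4 / 3 * (1 - b\<^sup>2)) / ?D w"
      using \<open>(1 - b\<^sup>2) * ?D w \<le> (1 - b\<^sup>2) * (4 / 3 * ?D z)\<close> p
      by (intro divide_le_divideI) (simp_all only: mult_ac)
    then show ?thesis by simp
  qed
  moreover have "(field_lift b v - field_lift b u) / (v - u) = (1 - b\<^sup>2) / ?D z"
    using z(3) assms(4) by simp
  moreover have "(field_lift b y - field_lift b x) / (y - x) = (1 - b\<^sup>2) / ?D w"
    using w assms(4) by simp
  ultimately show ?thesis by simp
qed

subsection \<open>Expansion\<close>

text \<open>This is the Cauchy-Schwarz inequality between the powers of \<open>r\<close> and a
  constant sequence. It is strict since the variance of the powers about their mean \<open>m\<close>
  is positive: the powers with exponents \<open>0\<close> and \<open>1\<close> differ.\<close>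

lemma power_sum_ratio_gt_one:
  fixes r :: real
  assumes "0 \<le> r" "r < 1" "2 \<le> d"
  shows "1 < real d * (\<Sum>j<d. (r\<^sup>2) ^ j) / (\<Sum>j<d. r ^ j)\<^sup>2"
proof -
  define S where "S = (\<Sum>j<d. r ^ j)"
  define m where "m = S / d"
  have "(\<Sum>j<d. (r ^ j - m)\<^sup>2) \<noteq> 0"
  proof
    assume "(\<Sum>j<d. (r ^ j - m)\<^sup>2) = 0"
    then have "\<forall>j\<in>{..<d}. (r ^ j - m)\<^sup>2 = 0"
      by (subst (asm) sum_nonneg_eq_0_iff) auto
    moreover have "0 \<in> {..<d}" "1 \<in> {..<d}" using assms(3) by auto
    ultimately have "(r ^ 0 - m)\<^sup>2 = 0" "(r ^ 1 - m)\<^sup>2 = 0" by blast+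
    then show False using assms by simp
  qed
  then have pos: "0 < (\<Sum>j<d. (r ^ j - m)\<^sup>2)"
    by (simp add: order_less_le sum_nonneg)
  have "(\<Sum>j<d. (r ^ j - m)\<^sup>2) = (\<Sum>j<d. (r\<^sup>2) ^ j - 2 * m * r ^ j + m\<^sup>2)"
    by (intro sum.cong) (simp_all add: power2_eq_square power_mult_distrib algebra_simps)
  also have "\<dots> = (\<Sum>j<d. (r\<^sup>2) ^ j) - 2 * m * S + d * m\<^sup>2"
    by (simp add: sum.distrib sum_subtractf sum_distrib_left S_def)
  also have "\<dots> = (\<Sum>j<d. (r\<^sup>2) ^ j) - S\<^sup>2 / d"
    using assms(3) by (simp add: m_def power2_eq_square field_simps)
  finally have "S\<^sup>2 < d * (\<Sum>j<d. (r\<^sup>2) ^ j)"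
    using mult_pos_pos[of "real d", OF _ pos] assms(3) by (simp add: field_simps)
  moreover have "S > 0"
  proof -
    have "r ^ 0 \<le> S" unfolding S_def using assms by (intro member_le_sum) auto
    then show ?thesis by simp
  qed
  ultimately show ?thesis by (simp add: S_def)
qed

text \<open>The harmonic measures of the disc seen from \<open>p\<close> and from its image correspond under a disc
  automorphism.\<close>

lemma poisson_kernel_field_map:
  assumes b: "0 < b" "b < 1" and p: "norm p < 1"
  defines "q \<equiv> field_map b p"
  shows "(1 - (norm q)\<^sup>2) / (norm (cis (field_lift b x) - q))\<^sup>2 * ((1 - b\<^sup>2) / (1 + b\<^sup>2 + 2 * b * cos x))
    = (1 - (norm p)\<^sup>2) / (norm (cis x - p))\<^sup>2"
proof -
  define A where "A = norm (1 + of_real b * cis x)"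
  define B where "B = norm (1 + of_real b * p)"
  define D where "D = norm (cis x - p)"
  have nz: "1 + of_real b * cis x \<noteq> 0" "1 + of_real b * p \<noteq> 0"
    using field_map_denom_nonzero[OF b] p by auto
  then have A: "A \<noteq> 0" and B: "B \<noteq> 0" by (simp_all add: A_def B_def)
  have D: "D \<noteq> 0" using p by (auto simp: D_def)
  have eqA: "1 + b\<^sup>2 + 2 * b * cos x = A\<^sup>2" by (simp only: A_def norm_denom_cis)
  have "cis (field_lift b x) - q = of_real (1 - b\<^sup>2) * (cis x - p) / ((1 + of_real b * cis x) * (1 + of_real b * p))"
    unfolding cis_field_lift[OF b] q_def field_map_def using nz
    by (simp add: diff_frac_eq power2_eq_square algebra_simps)
  moreover have "norm (of_real (1 - b\<^sup>2) :: complex) = 1 - b\<^sup>2"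
    unfolding norm_of_real using b by (simp add: abs_square_le_1)
  ultimately have nq: "norm (cis (field_lift b x) - q) = (1 - b\<^sup>2) * D / (A * B)"
    by (simp only: norm_divide norm_mult A_def B_def D_def)
  have "1 - (norm q)\<^sup>2 = (1 - b\<^sup>2) * (1 - (norm p)\<^sup>2) / B\<^sup>2"
    unfolding q_def B_def using one_minus_norm_field_map[OF b, of p] p by simp
  moreover have "1 - b\<^sup>2 \<noteq> 0" using b by (simp add: power2_eq_1_iff)
  ultimately show ?thesis unfolding nq eqA D_def[symmetric] using A B D
    by (simp add: power2_eq_square)
qed

text \<open>Let \<open>q = field_map b p\<close>. The edge map carries harmonic measure seen from
  \<open>p\<close> to harmonic measure seen from \<open>q\<close>. Then
  \<open>z \<mapsto> cis t * z ^ d\<close>, which sends \<open>q\<close> to \<open>p\<close>,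
  multiplies densities by at least \<open>\<kappa>\<close>. Hence the whole recursion expands the
  measure seen from its fixed point.\<close>

lemma disc_lift_expansion:
  assumes b: "0 < b" "b < 1" and d: "2 \<le> d" and p: "norm p < 1"
    and fixed: "cis t * field_map b p ^ d = p"
  obtains \<kappa> where "1 < \<kappa>"
    "\<And>x y. x \<le> y \<Longrightarrow> \<kappa> * (disc_lift p y - disc_lift p x) \<le>
       disc_lift p (t + d * field_lift b y) - disc_lift p (t + d * field_lift b x)"
proof -
  define q where "q = field_map b p"
  define r where "r = norm q"
  define S where "S = (\<Sum>j<d. r ^ j)"
  define S2 where "S2 = (\<Sum>j<d. (r\<^sup>2) ^ j)"
  define \<kappa> where "\<kappa> = real d * S2 / S\<^sup>2"
  define P where "P x = (1 - (norm p)\<^sup>2) / (norm (cis x - p))\<^sup>2" for x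
  define g where "g x = t + d * field_lift b x" for x
  define H' where "H' x = (1 - b\<^sup>2) / (1 + b\<^sup>2 + 2 * b * cos x)" for x
  have r: "0 \<le> r" "r < 1" using norm_field_map_less[OF b p] by (simp_all add: r_def q_def)
  have \<kappa>: "1 < \<kappa>" unfolding \<kappa>_def S_def S2_def by (rule power_sum_ratio_gt_one[OF r d])
  have H': "0 \<le> H' x" for x
    unfolding H'_def using field_lift_denom_pos[OF b, of x] b
    by (intro divide_nonneg_pos) (auto simp: abs_square_le_1)
  have np: "norm p = r ^ d"
    using arg_cong[OF fixed, of norm] by (simp add: norm_mult norm_power r_def q_def)
  have expand: "\<kappa> * P x \<le> P (g x) * (d * H' x)" for x
  proof -
    define w where "w = cis (field_lift b x)"
    \<comment> \<open>The factorisation \<open>w ^ d - q ^ d = (w - q) * T\<close> relates the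
      distance to \<open>p\<close> after the power map to the distance to \<open>q\<close> before
      it; bounding \<open>T\<close> termwise by \<open>S\<close> produces
      \<open>\<kappa>\<close>.\<close>
    define T where "T = (\<Sum>i<d. q ^ (d - Suc i) * w ^ i)"
    have "cis (g x) = cis t * w ^ d" by (simp only: g_def w_def cis_mult Complex.DeMoivre)
    then have "cis (g x) - p = cis t * (w ^ d - q ^ d)"
      using fixed by (simp add: q_def algebra_simps)
    also have "\<dots> = cis t * ((w - q) * T)" by (simp only: power_diff_sumr2 T_def)
    finally have eq: "norm (cis (g x) - p) = norm (w - q) * norm T" by (simp add: norm_mult)
    have "cis (g x) \<noteq> p" using p by auto
    then have pos: "norm (w - q) > 0" "norm T > 0" using eq by auto
    have "norm T \<le> (\<Sum>i<d. norm (q ^ (d - Suc i) * w ^ i))" unfolding T_def by (rule norm_sum)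
    also have "\<dots> = (\<Sum>i<d. r ^ (d - Suc i))" by (simp add: norm_mult norm_power r_def w_def)
    also have "\<dots> = S" unfolding S_def by (rule sum.nat_diff_reindex)
    finally have T: "norm T \<le> S" .
    have "1 - (norm p)\<^sup>2 = 1 - (r\<^sup>2) ^ d" by (simp add: np power_mult[symmetric] mult.commute)
    also have "\<dots> = (1 - r\<^sup>2) * S2" unfolding S2_def by (rule one_diff_power_eq)
    finally have np2: "1 - (norm p)\<^sup>2 = (1 - r\<^sup>2) * S2" .
    have S2: "0 \<le> S2" unfolding S2_def by (intro sum_nonneg) simp
    have "\<kappa> * P x = \<kappa> * ((1 - r\<^sup>2) / (norm (w - q))\<^sup>2 * H' x)"
      unfolding P_def using poisson_kernel_field_map[OF b p, of x] by (simp add: w_def q_def r_def H'_def)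
    also have "\<dots> = (1 - r\<^sup>2) * S2 / ((norm (w - q))\<^sup>2 * S\<^sup>2) * (d * H' x)"
      by (simp add: \<kappa>_def mult_ac)
    also have "\<dots> \<le> (1 - r\<^sup>2) * S2 / ((norm (w - q))\<^sup>2 * (norm T)\<^sup>2) * (d * H' x)"
      using T pos S2 H' r
      by (intro mult_right_mono divide_left_mono mult_left_mono power_mono mult_pos_pos)
         (auto simp: abs_square_le_1 intro!: mult_nonneg_nonneg)
    also have "\<dots> = P (g x) * (d * H' x)"
      unfolding P_def eq np2 by (simp add: power_mult_distrib)
    finally show ?thesis .
  qed
  have deriv: "((\<lambda>x. disc_lift p (g x) - \<kappa> * disc_lift p x) has_real_derivative
      P (g x) * (d * H' x) - \<kappa> * P x) (at x)" for x
  proof -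
    have "(g has_real_derivative d * H' x) (at x)"
      unfolding g_def[abs_def] H'_def using field_lift_deriv[OF b, of x]
      by (auto intro!: derivative_eq_intros)
    from DERIV_chain2[OF disc_lift_deriv[OF p] this] disc_lift_deriv[OF p, of x]
    show ?thesis unfolding P_def by (intro DERIV_diff DERIV_cmult)
  qed
  have "\<kappa> * (disc_lift p y - disc_lift p x) \<le> disc_lift p (g y) - disc_lift p (g x)" if "x \<le> y" for x y
  proof -
    have "disc_lift p (g x) - \<kappa> * disc_lift p x \<le> disc_lift p (g y) - \<kappa> * disc_lift p y"
    proof (rule DERIV_nonneg_imp_nondecreasing[OF that])
      fix z show "\<exists>D. ((\<lambda>x. disc_lift p (g x) - \<kappa> * disc_lift p x) has_real_derivative D) (at z) \<and> 0 \<le> D"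
        using deriv[of z] expand[of z] by (intro exI conjI) auto
    qed
    then show ?thesis by (simp add: algebra_simps)
  qed
  then show thesis using \<kappa> that by (simp add: g_def)
qed

text \<open>Points of the circle have distance between \<open>1 - norm p\<close> and
  \<open>2\<close> from \<open>p\<close>, so harmonic measure and arc length are comparable.\<close>

lemma disc_lift_diff_bounds:
  assumes "norm p < 1" "x \<le> y"
  shows "(1 - (norm p)\<^sup>2) / 4 * (y - x) \<le> disc_lift p y - disc_lift p x"
    and "disc_lift p y - disc_lift p x \<le> (1 - (norm p)\<^sup>2) / (1 - norm p)\<^sup>2 * (y - x)"
proof -
  have np: "0 \<le> 1 - (norm p)\<^sup>2" using assms by (simp add: abs_square_le_1)
  have bnd: "(1 - (norm p)\<^sup>2) / 4 \<le> (1 - (norm p)\<^sup>2) / (norm (cis z - p))\<^sup>2"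
    "(1 - (norm p)\<^sup>2) / (norm (cis z - p))\<^sup>2 \<le> (1 - (norm p)\<^sup>2) / (1 - norm p)\<^sup>2" for z
  proof -
    have le: "norm (cis z - p) \<le> 2" using norm_triangle_ineq4[of "cis z" p] assms by simp
    have ge: "1 - norm p \<le> norm (cis z - p)" using norm_triangle_ineq2[of "cis z" p] by simp
    have "(norm (cis z - p))\<^sup>2 \<le> 2\<^sup>2" using le by (intro power_mono) auto
    then show "(1 - (norm p)\<^sup>2) / 4 \<le> (1 - (norm p)\<^sup>2) / (norm (cis z - p))\<^sup>2"
      using np ge assms by (intro divide_left_mono) auto
    have "(1 - norm p)\<^sup>2 \<le> (norm (cis z - p))\<^sup>2" using ge assms by (intro power_mono) auto
    then show "(1 - (norm p)\<^sup>2) / (norm (cis z - p))\<^sup>2 \<le> (1 - (norm p)\<^sup>2) / (1 - norm p)\<^sup>2"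
      using np assms ge by (intro divide_left_mono mult_pos_pos) auto
  qed
  have "disc_lift p x - (1 - (norm p)\<^sup>2) / 4 * x \<le> disc_lift p y - (1 - (norm p)\<^sup>2) / 4 * y"
  proof (rule DERIV_nonneg_imp_nondecreasing[OF assms(2)])
    fix z show "\<exists>D. ((\<lambda>x. disc_lift p x - (1 - (norm p)\<^sup>2) / 4 * x) has_real_derivative D) (at z) \<and> 0 \<le> D"
      using disc_lift_deriv[OF assms(1), of z] bnd(1)[of z]
      by (intro exI conjI) (rule DERIV_diff, assumption, rule DERIV_cmult_Id, simp)
  qed
  then show "(1 - (norm p)\<^sup>2) / 4 * (y - x) \<le> disc_lift p y - disc_lift p x"
    unfolding right_diff_distrib by linarith
  have "(1 - (norm p)\<^sup>2) / (1 - norm p)\<^sup>2 * x - disc_lift p x \<le> (1 - (norm p)\<^sup>2) / (1 - norm p)\<^sup>2 * y - disc_lift p y"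
  proof (rule DERIV_nonneg_imp_nondecreasing[OF assms(2)])
    fix z show "\<exists>D. ((\<lambda>x. (1 - (norm p)\<^sup>2) / (1 - norm p)\<^sup>2 * x - disc_lift p x) has_real_derivative D) (at z) \<and> 0 \<le> D"
      using disc_lift_deriv[OF assms(1), of z] bnd(2)[of z]
      by (intro exI conjI) (rule DERIV_diff, rule DERIV_cmult_Id, assumption, simp)
  qed
  then show "disc_lift p y - disc_lift p x \<le> (1 - (norm p)\<^sup>2) / (1 - norm p)\<^sup>2 * (y - x)"
    unfolding right_diff_distrib by linarith
qed

subsection \<open>Density of the fields\<close>

lemma cis_sum:
  fixes n :: nat
  shows "cis (\<Sum>i<n. f i) = (\<Prod>i<n. cis (f i))"
  by (induction n) (simp_all flip: cis_mult)

lemma sum_step_function: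
  fixes A B C :: real
  shows "(\<Sum>i<Suc j + m. if i < j then A else if i = j then B else C) = j * A + B + m * C"
  by (induction m) (simp_all add: algebra_simps)

lemma dist_cis_le: "dist (cis x) (cis y) \<le> \<bar>x - y\<bar>"
proof -
  have "dist (cis x) (cis y) = norm (cis y * (cis (x - y) - 1))"
    by (simp add: dist_norm right_diff_distrib cis_mult)
  also have "\<dots> = norm (exp (\<i> * of_real (x - y)) - 1)"
    unfolding cis_conv_exp[symmetric] by (simp only: norm_mult norm_cis mult_1)
  also have "\<dots> = 2 * \<bar>sin ((x - y) / 2)\<bar>" by (rule dist_exp_i_1)
  also have "\<dots> \<le> \<bar>x - y\<bar>"
    using abs_sin_x_le_abs_x[of "(x - y) / 2"] by simp
  finally show ?thesis .
qed

text \<open>The principal arguments of \<open>F\<close> form a bounded infinite set and therefore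
  accumulate somewhere.\<close>

lemma infinite_on_circle_close_pair:
  assumes "infinite F" "F \<subseteq> unit_circle" "0 < \<epsilon>"
  obtains x y where "x < y" "y - x < \<epsilon>" "cis x \<in> F" "cis y \<in> F"
proof -
  have cis_Arg: "cis (Arg z) = z" if "z \<in> F" for z
  proof -
    have "norm z = 1" using that assms(2) by (auto simp: unit_circle_def)
    then show ?thesis using rcis_cmod_Arg[of z] by (simp add: rcis_def)
  qed
  have "inj_on Arg F" by (rule inj_onI) (metis cis_Arg)
  then have inf: "infinite (Arg ` F)" using assms(1) by (simp add: finite_image_iff)
  have "bounded (Arg ` F)"
    unfolding bounded_iff using Arg_bounded by (auto intro!: exI[of _ pi] simp: abs_le_iff less_imp_le minus_le_iff)
  then obtain l where "l islimpt (Arg ` F)"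
    using bounded_infinite_imp_islimpt[of "Arg ` F" "Arg ` F"] inf by auto
  then have inf': "infinite (Arg ` F \<inter> ball l (\<epsilon>/2))"
    using assms(3) islimpt_eq_infinite_ball[of l "Arg ` F"] by simp
  then obtain x where x: "x \<in> Arg ` F \<inter> ball l (\<epsilon>/2)"
    using infinite_imp_nonempty by blast
  obtain y where y: "y \<in> Arg ` F \<inter> ball l (\<epsilon>/2) - {x}"
    using infinite_imp_nonempty[OF infinite_remove[OF inf', of x]] by blast
  have "\<bar>x - l\<bar> < \<epsilon>/2" "\<bar>y - l\<bar> < \<epsilon>/2" using x y by (auto simp: dist_real_def abs_minus_commute)
  then have "\<bar>x - y\<bar> < \<epsilon>" by linarith
  moreover have "cis x \<in> F" "cis y \<in> F" using x y cis_Arg by auto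
  ultimately show thesis using that[of x y] that[of y x] y by (cases "x < y") auto
qed

text \<open>This separates the dynamics on the circle from the graphs: \<open>F\<close> stands for
  the fields of trees whose root has at most \<open>d\<close> children. The case
  \<open>k = 0\<close> of the closure condition puts \<open>cis t\<close> into
  \<open>F\<close>.\<close>

locale field_semigroup =
  fixes d :: nat and b t :: real and F :: "complex set"
  assumes d: "2 \<le> d" and b: "0 < b" "b < 1"
    and F_circle: "F \<subseteq> unit_circle"
    and F_closed: "\<And>k x. k \<le> d \<Longrightarrow> (\<And>i. i < k \<Longrightarrow> x i \<in> F) \<Longrightarrow> cis t * (\<Prod>i<k. field_map b (x i)) \<in> F"
    and nontrivial: "cis t \<noteq> 1" "cis t \<noteq> - 1"
begin

lemma norm_F: "z \<in> F \<Longrightarrow> norm z = 1"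
  using F_circle by (auto simp: unit_circle_def)

lemma F_closed_angle:
  assumes "k \<le> d" "\<And>i. i < k \<Longrightarrow> cis (x i) \<in> F"
  shows "cis (t + (\<Sum>i<k. field_lift b (x i))) \<in> F"
  using F_closed[OF assms(1), of "\<lambda>i. cis (x i)"] assms(2)
  by (simp add: cis_mult[symmetric] cis_sum cis_field_lift[OF b])

text \<open>With \<open>D\<close> the squared modulus of the denominator, the real part grows by
  \<open>2 * b * (Im z)^2 / D\<close>.\<close>

lemma Re_field_map_ge:
  assumes "norm z = 1"
  shows "Re z \<le> Re (field_map b z)" and "Re (field_map b z) = Re z \<Longrightarrow> z = 1 \<or> z = -1"
proof -
  have sq: "(Re z)\<^sup>2 + (Im z)\<^sup>2 = 1" using assms by (simp add: cmod_power2[symmetric])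
  define D where "D = (norm (1 + of_real b * z))\<^sup>2"
  have D: "D > 0" using field_map_denom_nonzero[OF b, of z] assms by (simp add: D_def)
  have "of_real D = (1 + of_real b * z) * cnj (1 + of_real b * z)"
    unfolding D_def by (simp add: complex_norm_square del: of_real_power)
  moreover have "cnj (1 + of_real b * z) \<noteq> 0"
    using field_map_denom_nonzero[OF b, of z] assms by (metis complex_cnj_zero_iff order_refl)
  ultimately have "field_map b z = (z + of_real b) * cnj (1 + of_real b * z) / of_real D"
    unfolding field_map_def by (simp only: mult_divide_mult_cancel_right not_False_eq_True)
  then have "Re (field_map b z) = Re ((z + of_real b) * cnj (1 + of_real b * z)) / D"
    by (simp only: Re_divide_of_real)
  moreover have "Re ((z + of_real b) * cnj (1 + of_real b * z)) - Re z * D = 2 * b * (Im z)\<^sup>2"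
  proof -
    have "Re ((z + of_real b) * cnj (1 + of_real b * z)) - Re z * D
      = b * ((Re z)\<^sup>2 + (Im z)\<^sup>2) + b - 2 * b * (Re z)\<^sup>2 + b\<^sup>2 * Re z * (1 - ((Re z)\<^sup>2 + (Im z)\<^sup>2))"
      unfolding D_def cmod_power2 by (simp add: power2_eq_square algebra_simps)
    also have "\<dots> = 2 * b * (1 - (Re z)\<^sup>2)" unfolding sq by (simp add: algebra_simps)
    also have "1 - (Re z)\<^sup>2 = (Im z)\<^sup>2" using sq by simp
    finally show ?thesis .
  qed
  ultimately have eq: "Re (field_map b z) - Re z = 2 * b * (Im z)\<^sup>2 / D"
    using D by (simp add: field_simps)
  moreover have "0 \<le> 2 * b * (Im z)\<^sup>2 / D" using b D by (intro divide_nonneg_pos) auto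
  ultimately show "Re z \<le> Re (field_map b z)" by linarith
  assume "Re (field_map b z) = Re z"
  then have "Im z = 0" using eq b D by simp
  then show "z = 1 \<or> z = -1" using sq by (auto simp: complex_eq_iff power2_eq_1_iff)
qed

lemma inj_on_field_map: "inj_on (field_map b) F"
proof (rule inj_onI)
  fix z w assume zw: "z \<in> F" "w \<in> F" "field_map b z = field_map b w"
  then have "1 + of_real b * z \<noteq> 0" "1 + of_real b * w \<noteq> 0"
    using field_map_denom_nonzero[OF b] norm_F by auto
  then have "(1 - (of_real b)\<^sup>2) * (z - w) = 0"
    using zw(3) by (simp add: field_map_def frac_eq_eq power2_eq_square algebra_simps)
  moreover have "1 - (of_real b :: complex)\<^sup>2 \<noteq> 0" 
  proof -
    have "1 - b\<^sup>2 \<noteq> 0" using b by (simp add: power2_eq_1_iff)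
    then have "of_real (1 - b\<^sup>2) \<noteq> (0 :: complex)" by (simp only: of_real_eq_0_iff simp_thms)
    then show ?thesis by simp
  qed
  ultimately show "z = w" by simp
qed

text \<open>If \<open>F\<close> were finite, \<open>field_map b ` F\<close> would be a finite group, hence \<open>1 \<in> F\<close>, and then
  \<open>field_map b\<close> would permute \<open>F\<close>; but it increases real parts.\<close>

lemma infinite_F: "infinite F"
proof
  assume fin: "finite F"
  define G where "G = field_map b ` F"
  have card_G: "card G = card F" unfolding G_def by (rule card_image[OF inj_on_field_map])
  have fin_G: "finite G" unfolding G_def using fin by simp
  have lam: "cis t \<in> F" using F_closed[of 0] by simp
  have one: "cis t * field_map b x \<in> F" if "x \<in> F" for x
    using F_closed[of 1 "\<lambda>_. x"] that d by simp
  have two: "cis t * (field_map b x * field_map b y) \<in> F" if "x \<in> F" "y \<in> F" for x y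
    using F_closed[of 2 "\<lambda>i. if i = 0 then x else y"] that d by (simp add: numeral_2_eq_2)
  have inj: "inj_on ((*) c) X" if "c \<noteq> 0" for c :: complex and X using that by (auto intro: inj_onI)
  have F_eq: "F = (*) (cis t) ` G"
  proof (rule card_subset_eq[symmetric, OF fin])
    show "(*) (cis t) ` G \<subseteq> F" using one by (auto simp: G_def)
    show "card ((*) (cis t) ` G) = card F" using card_G inj[of "cis t" G] by (simp add: card_image)
  qed
  have GG: "g * h \<in> G" if "g \<in> G" "h \<in> G" for g h
  proof -
    have "cis t * (g * h) \<in> F" using two that by (auto simp: G_def)
    then show ?thesis unfolding F_eq by auto
  qed
  obtain g where g: "g \<in> G" using lam by (auto simp: G_def)
  have g0: "g \<noteq> 0" using g norm_F norm_field_map_circle[OF b] by (force simp: G_def)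
  \<comment> \<open>Multiplication by \<open>g\<close> permutes the finite set \<open>G\<close>, so
    \<open>g\<close> itself is a multiple \<open>g * u\<close>, and cancelling gives
    \<open>u = 1\<close>.\<close>
  have "(*) g ` G = G"
    using GG[OF g] by (intro card_subset_eq[OF fin_G]) (auto simp: card_image[OF inj[OF g0]])
  then obtain u where "u \<in> G" "g = g * u" using g by (metis imageE)
  then have "1 \<in> G" using g0 by simp
  then obtain x where x: "x \<in> F" "field_map b x = 1" by (auto simp: G_def)
  have "1 + of_real b * x \<noteq> 0" using field_map_denom_nonzero[OF b] norm_F[OF x(1)] by auto
  then have "(1 - of_real b) * (x - 1) = 0"
    using x(2) by (simp add: field_map_def algebra_simps)
  then have "x = 1" using b by simp
  then have "1 \<in> F" using x by simp
  \<comment> \<open>As \<open>1\<close> is in \<open>F\<close>, the inverse of \<open>cis t\<close>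
    is in \<open>G\<close>; multiplying by it inside \<open>G\<close> writes every \<open>h\<close>
    as \<open>cis t\<close> times an element of \<open>G\<close>.\<close>
  have "G \<subseteq> F"
  proof
    fix h assume h: "h \<in> G"
    obtain g where "g \<in> G" "cis t * g = 1" using \<open>1 \<in> F\<close> F_eq by force
    then have "h = cis t * (g * h)" by (simp add: mult.assoc[symmetric])
    then show "h \<in> F" using F_eq GG[OF \<open>g \<in> G\<close> h] by blast
  qed
  then have "G = F" using card_subset_eq[OF fin] card_G by simp
  then have "(\<Sum>z\<in>F. Re (field_map b z)) = (\<Sum>z\<in>F. Re z)"
    using sum.reindex[OF inj_on_field_map, of Re] by (simp add: G_def)
  then have "(\<Sum>z\<in>F. Re (field_map b z) - Re z) = 0" by (simp add: sum_subtractf)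
  then have "Re (field_map b (cis t)) - Re (cis t) = 0"
    using sum_nonneg_eq_0_iff[OF fin, of "\<lambda>z. Re (field_map b z) - Re z"] Re_field_map_ge(1) norm_F lam
    by auto
  then show False using Re_field_map_ge(2)[of "cis t"] nontrivial by auto
qed

text \<open>The lift of the recursion step in which all \<open>d\<close> children carry the same
  field.\<close>

definition next_angle :: "real \<Rightarrow> real" where
  "next_angle x = t + d * field_lift b x"

text \<open>The gap bound \<open>\<rho>\<close> is relative to the length of the interval, so it is
  the quantity that improves under expansion. Angles are not reduced modulo \<open>2 * pi\<close>,
  which lets an interval grow until it wraps around the circle.\<close>

definition fine_chain :: "real \<Rightarrow> real \<Rightarrow> real \<Rightarrow> bool" where
  "fine_chain l u \<rho> \<longleftrightarrow> l < u \<and> cis l \<in> F \<and> cis u \<in> F \<and>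
     (\<forall>x. l \<le> x \<and> x < u \<longrightarrow> (\<exists>y. cis y \<in> F \<and> x < y \<and> y \<le> u \<and> y - x \<le> \<rho> * (u - l)))"

lemma next_angle_mono: "x < y \<Longrightarrow> next_angle x < next_angle y"
  using field_lift_strict_mono[OF b] d by (simp add: next_angle_def)

lemma cis_next_angle: "cis x \<in> F \<Longrightarrow> cis (next_angle x) \<in> F"
  using F_closed_angle[of d "\<lambda>_. x"] by (simp add: next_angle_def)

text \<open>When the \<open>d\<close> arguments of the product are moved from \<open>l\<close> to \<open>u\<close> one at a time, the length of the
  interval grows by \<open>d\<close> times the slope of \<open>field_lift\<close>, but the gaps grow only by the slope.\<close>

lemma fine_chain_step:
  assumes chain: "fine_chain l u \<rho>"
    and slope: "\<And>x y. l \<le> x \<Longrightarrow> x < y \<Longrightarrow> y \<le> u \<Longrightarrow>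
      field_lift b y - field_lift b x \<le> K * (next_angle u - next_angle l) / (u - l) * (y - x)"
    and K: "0 \<le> K"
  shows "fine_chain (next_angle l) (next_angle u) (K * \<rho>)"
proof -
  let ?H = "field_lift b"
  have lu: "l < u" "cis l \<in> F" "cis u \<in> F" using chain by (auto simp: fine_chain_def)
  have "\<exists>y. cis y \<in> F \<and> z < y \<and> y \<le> next_angle u \<and> y - z \<le> K * \<rho> * (next_angle u - next_angle l)"
    if z: "next_angle l \<le> z" "z < next_angle u" for z
  proof -
    \<comment> \<open>The angle obtained when \<open>j\<close> of the arguments have already been
      moved to \<open>u\<close> and the others are still at \<open>l\<close>.\<close>
    define v where "v j = t + (real j * ?H u + (real d - real j) * ?H l)" for j
    have v: "v 0 = next_angle l" "v d = next_angle u" by (simp_all add: v_def next_angle_def)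
    define k where "k = (LEAST j. z < v j)"
    have k: "z < v k" "k \<le> d" 
      using LeastI[of "\<lambda>j. z < v j" d] Least_le[of "\<lambda>j. z < v j" d] z(2) v(2) by (simp_all add: k_def)
    then have "k \<noteq> 0" using z(1) v(1) k(1) by (cases "k = 0") auto
    then obtain j where j: "k = Suc j" by (metis not0_implies_Suc)
    then have "\<not> z < v j" using not_less_Least[of j "\<lambda>j. z < v j"] by (simp add: k_def)
    define m where "m = d - Suc j"
    have d_eq: "d = Suc j + m" using k(2) j by (simp add: m_def)
    \<comment> \<open>The angle \<open>z\<close> lies between two consecutive values of
      \<open>v\<close>. With \<open>j\<close> arguments at \<open>u\<close> and \<open>m\<close> at
      \<open>l\<close>, the single moving argument has to contribute \<open>s\<close>; it is found
      by the intermediate value theorem and then pushed up to a point of the given chain.\<close>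
    define s where "s = z - (t + (real j * ?H u + real m * ?H l))"
    have s: "?H l \<le> s" "s < ?H u"
      using \<open>\<not> z < v j\<close> k(1) by (auto simp: v_def s_def j d_eq algebra_simps)
    have "\<forall>x. l \<le> x \<and> x \<le> u \<longrightarrow> isCont ?H x"
      using DERIV_isCont[OF field_lift_deriv[OF b]] by blast
    then obtain x where x: "l \<le> x" "x \<le> u" "?H x = s"
      using IVT[of ?H l s u] s lu(1) by auto
    then have "x < u" using s by (cases "x = u") auto
    then obtain y where y: "cis y \<in> F" "x < y" "y \<le> u" "y - x \<le> \<rho> * (u - l)"
      using chain x(1) by (auto simp: fine_chain_def)
    define z' where "z' = t + (real j * ?H u + ?H y + real m * ?H l)"
    have "cis z' \<in> F"
    proof -
      have "(\<Sum>i<d. ?H (if i < j then u else if i = j then y else l))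
        = (\<Sum>i<Suc j + m. if i < j then ?H u else if i = j then ?H y else ?H l)"
        unfolding d_eq by (intro sum.cong) auto
      also have "\<dots> = real j * ?H u + ?H y + real m * ?H l" by (rule sum_step_function)
      finally show ?thesis
        using F_closed_angle[of d "\<lambda>i. if i < j then u else if i = j then y else l"] y(1) lu
        by (simp add: z'_def)
    qed
    moreover have diff: "z' - z = ?H y - ?H x" by (simp add: z'_def x(3) s_def)
    moreover have "?H x < ?H y" by (rule field_lift_strict_mono[OF b y(2)])
    moreover have "z' \<le> next_angle u"
    proof -
      have "?H y \<le> ?H u" "?H l \<le> ?H u" using field_lift_mono[OF b] y(3) lu(1) by auto
      then have "real m * ?H l \<le> real m * ?H u" by (intro mult_left_mono) auto
      moreover have "real d = real j + 1 + real m" using d_eq by simp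
      ultimately show ?thesis using \<open>?H y \<le> ?H u\<close>
        unfolding z'_def next_angle_def by (simp add: algebra_simps)
    qed
    moreover have "z' - z \<le> K * \<rho> * (next_angle u - next_angle l)"
    proof -
      have "z' - z \<le> K * (next_angle u - next_angle l) / (u - l) * (y - x)"
        unfolding diff by (rule slope[OF x(1) y(2,3)])
      also have "\<dots> \<le> K * (next_angle u - next_angle l) / (u - l) * (\<rho> * (u - l))"
        using K lu(1) next_angle_mono[OF lu(1)] y(4) by (intro mult_left_mono) auto
      also have "\<dots> = K * \<rho> * (next_angle u - next_angle l)" using lu(1) by simp
      finally show ?thesis .
    qed
    ultimately show ?thesis by (intro exI[of _ z']) auto
  qed
  then show ?thesis unfolding fine_chain_def using lu next_angle_mono cis_next_angle by auto
qed

lemma fine_chain_weaken: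
  assumes "fine_chain l u \<rho>" "\<rho> \<le> \<rho>'"
  shows "fine_chain l u \<rho>'"
proof -
  have "\<rho> * (u - l) \<le> \<rho>' * (u - l)"
    using assms by (intro mult_right_mono) (auto simp: fine_chain_def)
  then show ?thesis using assms(1) unfolding fine_chain_def by (meson order_trans)
qed

lemma fine_chain_nonneg: "fine_chain l u \<rho> \<Longrightarrow> 0 \<le> \<rho>"
proof -
  assume "fine_chain l u \<rho>"
  then obtain y where "l < u" "l < y" "y - l \<le> \<rho> * (u - l)" unfolding fine_chain_def by blast
  then have "0 < \<rho> * (u - l)" by linarith
  with \<open>l < u\<close> show ?thesis by (simp add: zero_less_mult_iff)
qed

text \<open>Distortion costs at most \<open>4 / 3\<close>, while moving the arguments one at a time
  gains the factor \<open>d\<close>, which is at least \<open>2\<close>.\<close>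

lemma fine_chain_step_short:
  assumes "fine_chain l u \<rho>" "u - l \<le> (1 - b)\<^sup>2 / 6"
  shows "fine_chain (next_angle l) (next_angle u) (2 / 3 * \<rho>)"
proof -
  have lu: "l < u" using assms(1) by (simp add: fine_chain_def)
  have "fine_chain (next_angle l) (next_angle u) (4 / (3 * real d) * \<rho>)"
  proof (rule fine_chain_step[OF assms(1)])
    fix x y assume xy: "l \<le> x" "x < y" "y \<le> u"
    have "field_lift b y - field_lift b x = (field_lift b y - field_lift b x) / (y - x) * (y - x)"
      using xy by simp
    also have "\<dots> \<le> 4 / 3 * ((field_lift b u - field_lift b l) / (u - l)) * (y - x)"
      using xy by (intro mult_right_mono field_lift_distortion[OF b xy assms(2)]) auto
    also have "\<dots> = 4 / (3 * real d) * (next_angle u - next_angle l) / (u - l) * (y - x)"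
    proof -
      have "4 / 3 * (field_lift b u - field_lift b l) = 4 / (3 * real d) * (next_angle u - next_angle l)"
        using d by (simp add: next_angle_def field_simps)
      then show ?thesis by (simp only: times_divide_eq_right)
    qed
    finally show "field_lift b y - field_lift b x \<le> 4 / (3 * real d) * (next_angle u - next_angle l) / (u - l) * (y - x)" .
  qed simp
  moreover have "4 / (3 * real d) * \<rho> \<le> 2 / 3 * \<rho>"
    using d fine_chain_nonneg[OF assms(1)] by (intro mult_right_mono) (auto simp: field_simps)
  ultimately show ?thesis by (rule fine_chain_weaken)
qed

lemma next_angle_diff_bounds:
  assumes "x \<le> y"
  shows "d * ((1 - b) / (1 + b)) * (y - x) \<le> next_angle y - next_angle x"
    and "next_angle y - next_angle x \<le> d * ((1 + b) / (1 - b)) * (y - x)"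
proof -
  have "next_angle y - next_angle x = d * (field_lift b y - field_lift b x)"
    by (simp add: next_angle_def right_diff_distrib)
  then show "d * ((1 - b) / (1 + b)) * (y - x) \<le> next_angle y - next_angle x"
    and "next_angle y - next_angle x \<le> d * ((1 + b) / (1 - b)) * (y - x)"
    unfolding mult.assoc using field_lift_diff_bounds[OF b assms] by (simp_all only: mult_left_mono of_nat_0_le_iff)
qed

text \<open>For long intervals only the global slope bounds are available. The resulting factor may
  exceed \<open>1\<close>, which is harmless when the number of such steps is fixed
  beforehand.\<close>

lemma fine_chain_step_long:
  assumes "fine_chain l u \<rho>"
  shows "fine_chain (next_angle l) (next_angle u) (((1 + b) / (1 - b))\<^sup>2 / d * \<rho>)"
proof (rule fine_chain_step[OF assms])
  have lu: "l < u" using assms(1) by (simp add: fine_chain_def)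
  fix x y assume xy: "l \<le> x" "x < y" "y \<le> u"
  have "field_lift b y - field_lift b x \<le> (1 + b) / (1 - b) * (y - x)"
    using field_lift_diff_bounds(2)[OF b] xy by simp
  also have "\<dots> \<le> ((1 + b) / (1 - b))\<^sup>2 / d * (next_angle u - next_angle l) / (u - l) * (y - x)"
  proof (rule mult_right_mono)
    have "(1 + b) / (1 - b) * (u - l) = ((1 + b) / (1 - b))\<^sup>2 / d * (d * ((1 - b) / (1 + b)) * (u - l))"
      using b d by (simp add: power2_eq_square)
    also have "\<dots> \<le> ((1 + b) / (1 - b))\<^sup>2 / d * (next_angle u - next_angle l)"
      using lu by (intro mult_left_mono next_angle_diff_bounds) auto
    finally show "(1 + b) / (1 - b) \<le> ((1 + b) / (1 - b))\<^sup>2 / d * (next_angle u - next_angle l) / (u - l)"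
      using lu by (simp only: pos_le_divide_eq diff_gt_0_iff_gt)
  qed (use xy in simp)
  finally show "field_lift b y - field_lift b x \<le> ((1 + b) / (1 - b))\<^sup>2 / d * (next_angle u - next_angle l) / (u - l) * (y - x)" .
qed simp

lemma iterate_next_angle_mono: "x < y \<Longrightarrow> (next_angle ^^ n) x < (next_angle ^^ n) y"
  by (induction n) (simp_all add: next_angle_mono)

lemma iterate_next_angle_upper:
  assumes "x < y"
  shows "(next_angle ^^ n) y - (next_angle ^^ n) x \<le> (d * ((1 + b) / (1 - b))) ^ n * (y - x)"
proof (induction n)
  case (Suc n)
  have "(next_angle ^^ Suc n) y - (next_angle ^^ Suc n) x
    \<le> d * ((1 + b) / (1 - b)) * ((next_angle ^^ n) y - (next_angle ^^ n) x)"
    using next_angle_diff_bounds(2)[OF less_imp_le[OF iterate_next_angle_mono[OF assms]]] by simp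
  also have "\<dots> \<le> d * ((1 + b) / (1 - b)) * ((d * ((1 + b) / (1 - b))) ^ n * (y - x))"
    using b by (intro mult_left_mono Suc.IH) auto
  finally show ?case by (simp only: power_Suc mult.assoc)
qed simp

text \<open>In the harmonic length every step gains the factor \<open>\<kappa>\<close>. Passing to
  arc length is done only at the two ends of the iteration and costs the constant
  \<open>c1 / c2\<close>, independent of \<open>n\<close>.\<close>

lemma iterate_next_angle_lower:
  assumes p: "norm p < 1" "cis t * field_map b p ^ d = p"
  obtains c \<kappa> where "0 < c" "1 < \<kappa>"
    "\<And>n x y. x < y \<Longrightarrow> c * \<kappa> ^ n * (y - x) \<le> (next_angle ^^ n) y - (next_angle ^^ n) x"
proof -
  obtain \<kappa> where \<kappa>: "1 < \<kappa>" "\<And>x y. x \<le> y \<Longrightarrow> \<kappa> * (disc_lift p y - disc_lift p x) \<le>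
       disc_lift p (next_angle y) - disc_lift p (next_angle x)"
    using disc_lift_expansion[OF b d p] unfolding next_angle_def by blast
  define c1 where "c1 = (1 - (norm p)\<^sup>2) / 4"
  define c2 where "c2 = (1 - (norm p)\<^sup>2) / (1 - norm p)\<^sup>2"
  have pos: "0 < c1" "0 < c2" using p(1) by (auto simp: c1_def c2_def abs_square_less_1)
  have iter: "\<kappa> ^ n * (disc_lift p y - disc_lift p x) \<le>
      disc_lift p ((next_angle ^^ n) y) - disc_lift p ((next_angle ^^ n) x)" if "x < y" for n x y
  proof (induction n)
    case (Suc n)
    have "\<kappa> * (\<kappa> ^ n * (disc_lift p y - disc_lift p x))
      \<le> \<kappa> * (disc_lift p ((next_angle ^^ n) y) - disc_lift p ((next_angle ^^ n) x))"
      using \<kappa>(1) by (intro mult_left_mono Suc.IH) auto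
    also have "\<dots> \<le> disc_lift p ((next_angle ^^ Suc n) y) - disc_lift p ((next_angle ^^ Suc n) x)"
      using \<kappa>(2)[OF less_imp_le[OF iterate_next_angle_mono[OF that]]] by simp
    finally show ?case by (simp only: power_Suc mult.assoc)
  qed simp
  have "c1 / c2 * \<kappa> ^ n * (y - x) \<le> (next_angle ^^ n) y - (next_angle ^^ n) x" if "x < y" for n x y
  proof -
    have "\<kappa> ^ n * (c1 * (y - x)) \<le> \<kappa> ^ n * (disc_lift p y - disc_lift p x)"
      using \<kappa>(1) disc_lift_diff_bounds(1)[OF p(1), of x y] that
      by (intro mult_left_mono) (auto simp: c1_def)
    also note iter[OF that]
    also have "disc_lift p ((next_angle ^^ n) y) - disc_lift p ((next_angle ^^ n) x)
      \<le> c2 * ((next_angle ^^ n) y - (next_angle ^^ n) x)"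
      using disc_lift_diff_bounds(2)[OF p(1) less_imp_le[OF iterate_next_angle_mono[OF that]]]
      by (simp add: c2_def)
    finally show ?thesis using pos by (simp add: field_simps)
  qed
  then show thesis using that[of "c1 / c2" \<kappa>] \<kappa>(1) pos by auto
qed

lemma iterate_fine_chain_short:
  assumes "fine_chain l u \<rho>" "\<And>k. k < n \<Longrightarrow> (next_angle ^^ k) u - (next_angle ^^ k) l \<le> (1 - b)\<^sup>2 / 6"
  shows "fine_chain ((next_angle ^^ n) l) ((next_angle ^^ n) u) ((2 / 3) ^ n * \<rho>)"
  using assms(2)
proof (induction n)
  case (Suc n)
  then have "fine_chain ((next_angle ^^ n) l) ((next_angle ^^ n) u) ((2 / 3) ^ n * \<rho>)" by simp
  from fine_chain_step_short[OF this Suc.prems[of n]] show ?case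
    by (simp only: power_Suc mult.assoc funpow.simps o_apply lessI)
qed (use assms in simp)

lemma iterate_fine_chain_long:
  assumes "fine_chain l u \<rho>"
  shows "fine_chain ((next_angle ^^ n) l) ((next_angle ^^ n) u) ((((1 + b) / (1 - b))\<^sup>2 / d) ^ n * \<rho>)"
proof (induction n)
  case (Suc n)
  from fine_chain_step_long[OF this] show ?case
    by (simp only: power_Suc mult.assoc funpow.simps o_apply)
qed (use assms in simp)

text \<open>A short pair of fields is first expanded by maps that are nearly linear at that scale, which
  shrinks the relative gaps by a factor \<open>2 / 3\<close> each time; once it has a macroscopic length, boundedly
  many further steps spread it over the whole circle.\<close>

lemma exists_long_fine_chain:
  assumes p: "norm p < 1" "cis t * field_map b p ^ d = p" and \<epsilon>: "0 < \<epsilon>"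
  obtains l u \<rho> where "fine_chain l u \<rho>" "2 * pi \<le> u - l" "\<rho> * (u - l) < \<epsilon>"
proof -
  let ?g = "\<lambda>n. next_angle ^^ n"
  define c0 where "c0 = (1 - b)\<^sup>2 / 6"
  define M where "M = d * ((1 + b) / (1 - b))"
  define C where "C = ((1 + b) / (1 - b))\<^sup>2 / d"
  obtain c \<kappa> where c\<kappa>: "0 < c" "1 < \<kappa>"
    "\<And>n x y. x < y \<Longrightarrow> c * \<kappa> ^ n * (y - x) \<le> ?g n y - ?g n x"
    using iterate_next_angle_lower[OF p] by blast
  have c0: "c0 > 0" using b by (simp add: c0_def)
  have C: "C > 0" using b d by (simp add: C_def)
  have M: "M \<ge> 1"
  proof -
    have "1 * 1 \<le> M" unfolding M_def using b d by (intro mult_mono) (auto simp: field_simps)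
    then show ?thesis by simp
  qed
  have upper: "?g n y - ?g n x \<le> M ^ n * (y - x)" if "x < y" for n x y
    using iterate_next_angle_upper[OF that] by (simp add: M_def)
  \<comment> \<open>The number of further steps that stretch an interval longer than
    \<open>c0\<close> to a full turn.\<close>
  obtain m where m: "2 * pi / (c * c0) < \<kappa> ^ m" using real_arch_pow[OF c\<kappa>(2)] by blast
  \<comment> \<open>After \<open>n\<close> short and \<open>m\<close> long steps the absolute gap is
    at most \<open>(2 / 3) ^ n * A\<close>: the long steps contribute \<open>C ^ m\<close> to the
    relative gap, and the last factor bounds the final length.\<close>
  define A where "A = C ^ m * (M ^ m * (M * c0))"
  have A: "A > 0" using C M c0 by (simp add: A_def)
  obtain n0 where n0: "(2 / 3 :: real) ^ n0 < \<epsilon> / A"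
    using real_arch_pow_inv[of "\<epsilon> / A" "2 / 3"] \<epsilon> A by auto
  \<comment> \<open>Each step lengthens an interval at most by the factor \<open>M\<close>, so a
    pair this close needs more than \<open>n0\<close> steps to become longer than
    \<open>c0\<close>.\<close>
  obtain x y where xy: "x < y" "y - x < c0 / M ^ n0" "cis x \<in> F" "cis y \<in> F"
    using infinite_on_circle_close_pair[OF infinite_F F_circle, of "c0 / M ^ n0"] c0 M by auto
  have start: "fine_chain x y 1" unfolding fine_chain_def using xy by auto
  \<comment> \<open>The first time the length exceeds \<open>c0\<close>: all earlier intervals are
    short enough for the gain \<open>2 / 3\<close>, and the length reached is at most
    \<open>M * c0\<close>.\<close>
  define n where "n = (LEAST n. c0 < ?g n y - ?g n x)"
  have ex: "c0 < ?g n y - ?g n x"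
  proof -
    obtain k where "c0 / (c * (y - x)) < \<kappa> ^ k" using real_arch_pow[OF c\<kappa>(2)] by blast
    then have "c0 < c * \<kappa> ^ k * (y - x)" using c\<kappa>(1) xy(1) by (simp add: field_simps)
    also have "\<dots> \<le> ?g k y - ?g k x" by (rule c\<kappa>(3)[OF xy(1)])
    finally show ?thesis unfolding n_def by (rule LeastI)
  qed
  have small: "?g k y - ?g k x \<le> c0" if "k < n" for k
    using not_less_Least[of k "\<lambda>n. c0 < ?g n y - ?g n x"] that by (simp add: n_def)
  have "n0 < n"
  proof (rule ccontr)
    assume "\<not> n0 < n"
    then have "M ^ n \<le> M ^ n0" using M by (intro power_increasing) auto
    then have "M ^ n * (y - x) \<le> M ^ n0 * (y - x)" using xy(1) by (intro mult_right_mono) auto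
    also have "\<dots> < c0" using xy(2) M by (simp add: field_simps)
    finally show False using ex upper[OF xy(1), of n] by linarith
  qed
  then obtain k where k: "n = Suc k" by (cases n) auto
  have "?g n y - ?g n x \<le> M * (?g k y - ?g k x)"
    using upper[of "?g k x" "?g k y" 1] iterate_next_angle_mono[OF xy(1)] by (simp add: k)
  also have "\<dots> \<le> M * c0" using small[of k] M by (intro mult_left_mono) (auto simp: k)
  finally have len: "?g n y - ?g n x \<le> M * c0" .
  define l u \<rho> where "l = ?g m (?g n x)" and "u = ?g m (?g n y)" and "\<rho> = C ^ m * (2 / 3) ^ n"
  have lt: "?g n x < ?g n y" by (rule iterate_next_angle_mono[OF xy(1)])
  have "fine_chain (?g n x) (?g n y) ((2 / 3) ^ n * 1)"
    using small by (intro iterate_fine_chain_short[OF start]) (simp add: c0_def)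
  then have chain: "fine_chain l u \<rho>"
    using iterate_fine_chain_long[of "?g n x" "?g n y" "(2 / 3) ^ n" m]
    by (simp add: l_def u_def \<rho>_def C_def)
  have "2 * pi \<le> c * \<kappa> ^ m * c0" using m c0 c\<kappa>(1) by (simp add: field_simps)
  also have "\<dots> \<le> c * \<kappa> ^ m * (?g n y - ?g n x)" using ex c\<kappa>(1,2) by (intro mult_left_mono) auto
  also have "\<dots> \<le> u - l" unfolding l_def u_def by (rule c\<kappa>(3)[OF lt])
  finally have long: "2 * pi \<le> u - l" .
  have "u - l \<le> M ^ m * (?g n y - ?g n x)" unfolding l_def u_def by (rule upper[OF lt])
  also have "\<dots> \<le> M ^ m * (M * c0)" using len M by (intro mult_left_mono) auto
  finally have "\<rho> * (u - l) \<le> \<rho> * (M ^ m * (M * c0))"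
    using C by (intro mult_left_mono) (auto simp: \<rho>_def)
  also have "\<dots> = (2 / 3) ^ n * A" by (simp add: \<rho>_def A_def)
  also have "\<dots> \<le> (2 / 3) ^ n0 * A"
    using \<open>n0 < n\<close> A by (intro mult_right_mono power_decreasing) auto
  also have "\<dots> < \<epsilon>" using n0 A by (simp add: pos_less_divide_eq)
  finally show thesis using that chain long by blast
qed

lemma F_dense:
  assumes "norm p < 1" "cis t * field_map b p ^ d = p"
  shows "unit_circle \<subseteq> closure F"
proof
  fix z :: complex assume "z \<in> unit_circle"
  then have z: "z = cis (Arg z)" using rcis_cmod_Arg[of z] by (simp add: unit_circle_def rcis_def)
  define \<alpha> where "\<alpha> = Arg z"
  show "z \<in> closure F"
    unfolding closure_approachable
  proof (intro allI impI)
    fix \<epsilon> :: real assume "0 < \<epsilon>"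
    then obtain l u \<rho> where lu: "fine_chain l u \<rho>" "2 * pi \<le> u - l" "\<rho> * (u - l) < \<epsilon>"
      using exists_long_fine_chain[OF assms] by blast
    \<comment> \<open>Translation by \<open>k\<close> full turns brings the angle of
      \<open>z\<close> into \<open>[l, l + 2 * pi)\<close>, which is covered by the chain.\<close>
    define k where "k = \<lceil>(l - \<alpha>) / (2 * pi)\<rceil>"
    define x where "x = \<alpha> + 2 * pi * of_int k"
    have "(l - \<alpha>) / (2 * pi) \<le> of_int k" "of_int k < (l - \<alpha>) / (2 * pi) + 1"
      unfolding k_def by linarith+
    then have "l \<le> x" "x < l + 2 * pi" using pi_gt_zero
      by (simp_all add: x_def field_simps)
    moreover from this have "x < u" using lu(2) by linarith
    ultimately obtain y where y: "cis y \<in> F" "x < y" "y - x \<le> \<rho> * (u - l)"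
      using lu(1) unfolding fine_chain_def by blast
    have "cis x = z" using z by (simp add: x_def \<alpha>_def cis_mult[symmetric])
    then have "dist (cis y) z < \<epsilon>" using dist_cis_le[of y x] y lu(3) by simp
    then show "\<exists>w\<in>F. dist w z < \<epsilon>" using y(1) by blast
  qed
qed

end

subsection \<open>Fixed points in the disc and on the circle\<close>

text \<open>Brouwer's theorem gives fixed points of the contracted maps \<open>r * cis t * field_map b z ^ d\<close>;
  a limit as \<open>r\<close> tends to \<open>1\<close> which lies on the circle has derivative at most \<open>1\<close>, as in the
  Julia-Wolff theorem.\<close>

lemma fixed_point_dichotomy:
  assumes b: "0 < b" "b < 1"
  shows "(\<exists>p. norm p < 1 \<and> cis t * field_map b p ^ d = p) \<or>
    (\<exists>p. norm p = 1 \<and> cis t * field_map b p ^ d = p \<and> d * (1 - b\<^sup>2) \<le> (norm (1 + of_real b * p))\<^sup>2)"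
proof -
  define r where "r n = real (Suc n) / real (Suc (Suc n))" for n
  have r: "0 < r n" "r n < 1" for n by (auto simp: r_def)
  have r_lim: "r \<longlonglongrightarrow> 1" unfolding r_def by (rule LIMSEQ_Suc[OF LIMSEQ_n_over_Suc_n])
  have "\<exists>z\<in>cball 0 1. of_real (r n) * (cis t * field_map b z ^ d) = z" for n
  proof -
    have maps: "(\<lambda>z. of_real (r n) * (cis t * field_map b z ^ d)) \<in> cball 0 1 \<rightarrow> cball 0 1"
    proof
      fix z :: complex assume "z \<in> cball 0 1"
      then have "norm (field_map b z) ^ d \<le> 1" using norm_field_map_le[OF b, of z] by (simp add: power_le_one)
      then have "r n * norm (field_map b z) ^ d \<le> 1 * 1" using r[of n] by (intro mult_mono) auto
      then show "of_real (r n) * (cis t * field_map b z ^ d) \<in> cball 0 1"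
        using r[of n] by (simp add: norm_mult norm_power)
    qed
    show ?thesis
      by (rule brouwer[of "cball 0 1" "\<lambda>z. of_real (r n) * (cis t * field_map b z ^ d)"])
         (use maps in \<open>auto intro!: continuous_intros continuous_on_field_map[OF b]\<close>)
  qed
  then obtain z where z: "norm (z n) \<le> 1" "of_real (r n) * (cis t * field_map b (z n) ^ d) = z n" for n
    by (metis dist_0_norm mem_cball)
  have z_lt: "norm (z n) < 1" "norm (z n) \<le> norm (field_map b (z n)) ^ d" for n
  proof -
    have eq: "norm (z n) = r n * norm (field_map b (z n)) ^ d"
      using arg_cong[OF z(2)[of n], of norm] r[of n] by (simp add: norm_mult norm_power)
    have "norm (field_map b (z n)) ^ d \<le> 1" using norm_field_map_le[OF b z(1)[of n]] by (simp add: power_le_one)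
    then have "r n * norm (field_map b (z n)) ^ d \<le> r n * 1" using r[of n] by (intro mult_left_mono) auto
    then show "norm (z n) < 1" using eq r[of n] by linarith
    have "r n * norm (field_map b (z n)) ^ d \<le> 1 * norm (field_map b (z n)) ^ d"
      using r[of n] by (intro mult_right_mono) auto
    then show "norm (z n) \<le> norm (field_map b (z n)) ^ d" using eq by simp
  qed
  have "compact (cball (0 :: complex) 1)" by simp
  then have "\<exists>p\<in>cball 0 1. \<exists>s. strict_mono s \<and> (z \<circ> s) \<longlonglongrightarrow> p"
    using z(1) unfolding compact_def by auto
  then obtain p s where p: "norm p \<le> 1" "strict_mono s" "(z \<circ> s) \<longlonglongrightarrow> p" by auto
  have h_lim: "(\<lambda>n. field_map b (z (s n))) \<longlonglongrightarrow> field_map b p"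
    using continuous_on_tendsto_compose[OF continuous_on_field_map[OF b] p(3)[unfolded o_def]] p(1) z(1)
    by simp
  have r_lim': "(\<lambda>n. r (s n)) \<longlonglongrightarrow> 1" using LIMSEQ_subseq_LIMSEQ[OF r_lim p(2)] by (simp add: o_def)
  have "(\<lambda>n. of_real (r (s n)) * (cis t * field_map b (z (s n)) ^ d)) \<longlonglongrightarrow> of_real 1 * (cis t * field_map b p ^ d)"
    by (intro tendsto_intros r_lim' h_lim)
  then have "(z \<circ> s) \<longlonglongrightarrow> cis t * field_map b p ^ d" unfolding z(2) by (simp add: o_def)
  then have fixed: "cis t * field_map b p ^ d = p" using LIMSEQ_unique p(3) by blast
  show ?thesis
  proof (cases "norm p < 1")
    case False
    then have np: "norm p = 1" using p(1) by simp
    \<comment> \<open>The Schwarz-Pick identity expresses \<open>1 - \<sigma>\<close> through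
      \<open>1 - (norm (z n))^2\<close>, and \<open>norm (z n)\<close> is at most the
      \<open>d\<close>-th power of the norm of its image. The positive factor
      \<open>1 - (norm (z n))^2\<close> cancels before the limit is taken.\<close>
    have ineq: "(1 - b\<^sup>2) * (\<Sum>j<d. ((norm (field_map b (z n)))\<^sup>2) ^ j) \<le> (norm (1 + of_real b * z n))\<^sup>2" for n
    proof -
      define \<sigma> where "\<sigma> = (norm (field_map b (z n)))\<^sup>2"
      define D where "D = (norm (1 + of_real b * z n))\<^sup>2"
      have D: "D > 0" using field_map_denom_nonzero[OF b z(1)[of n]] by (simp add: D_def)
      have pos: "0 < 1 - (norm (z n))\<^sup>2" using z_lt(1)[of n] by (simp add: abs_square_less_1)
      have "(norm (z n))\<^sup>2 \<le> (norm (field_map b (z n)) ^ d)\<^sup>2" using z_lt(2)[of n] by (intro power_mono) auto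
      also have "\<dots> = \<sigma> ^ d" by (simp add: \<sigma>_def power_mult[symmetric] mult.commute)
      finally have "1 - \<sigma> ^ d \<le> 1 - (norm (z n))\<^sup>2" by simp
      then have "(1 - \<sigma>) * (\<Sum>j<d. \<sigma> ^ j) \<le> 1 - (norm (z n))\<^sup>2" by (simp only: one_diff_power_eq)
      moreover have "1 - \<sigma> = (1 - b\<^sup>2) * (1 - (norm (z n))\<^sup>2) / D"
        unfolding \<sigma>_def D_def by (rule one_minus_norm_field_map[OF b z(1)])
      ultimately have "((1 - b\<^sup>2) * (\<Sum>j<d. \<sigma> ^ j)) * (1 - (norm (z n))\<^sup>2) \<le> D * (1 - (norm (z n))\<^sup>2)"
        using D by (simp add: pos_divide_le_eq mult_ac)
      then show ?thesis using pos by (simp add: \<sigma>_def D_def)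
    qed
    have "(\<lambda>n. (1 - b\<^sup>2) * (\<Sum>j<d. ((norm (field_map b (z (s n))))\<^sup>2) ^ j)) \<longlonglongrightarrow>
      (1 - b\<^sup>2) * (\<Sum>j<d. ((norm (field_map b p))\<^sup>2) ^ j)"
      by (intro tendsto_intros h_lim)
    moreover have "(\<lambda>n. (norm (1 + of_real b * z (s n)))\<^sup>2) \<longlonglongrightarrow> (norm (1 + of_real b * p))\<^sup>2"
      using p(3) by (intro tendsto_intros) (simp add: o_def)
    ultimately have "(1 - b\<^sup>2) * (\<Sum>j<d. ((norm (field_map b p))\<^sup>2) ^ j) \<le> (norm (1 + of_real b * p))\<^sup>2"
      by (rule LIMSEQ_le) (use ineq in blast)
    \<comment> \<open>At the limit the image of \<open>p\<close> has norm \<open>1\<close>, so the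
      power sum becomes \<open>d\<close>.\<close>
    then have "d * (1 - b\<^sup>2) \<le> (norm (1 + of_real b * p))\<^sup>2"
      using norm_field_map_circle[OF b np] by (simp add: mult.commute)
    then show ?thesis using np fixed by blast
  qed (use fixed in blast)
qed

text \<open>For these \<open>b\<close> one has \<open>(1 + b)^2 \<le> d * (1 - b^2)\<close>, so the
  derivative bound at a boundary fixed point can hold only at \<open>p = 1\<close>. But
  \<open>1\<close> is fixed by \<open>field_map b\<close>, and then
  \<open>cis t = 1\<close>.\<close>

lemma fixed_point_in_disc_of_small_b:
  assumes b: "0 < b" "b \<le> (real d - 1) / (real d + 1)" and ne: "cis t \<noteq> 1"
  obtains p where "norm p < 1" "cis t * field_map b p ^ d = p"
proof -
  have "(real d - 1) / (real d + 1) < 1" by simp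
  then have b1: "b < 1" using b by linarith
  have db: "1 + b \<le> d * (1 - b)" using b(2) by (simp add: field_simps)
  have "norm p < 1" if "norm p = 1" "cis t * field_map b p ^ d = p" "d * (1 - b\<^sup>2) \<le> (norm (1 + of_real b * p))\<^sup>2" for p
  proof -
    have p: "p = cis (Arg p)" using rcis_cmod_Arg[of p] that(1) by (simp add: rcis_def)
    have "(1 + b) * (1 + b) \<le> d * (1 - b) * (1 + b)" using db b by (intro mult_right_mono) auto
    then have "(1 + b) * (1 + b) \<le> d * (1 - b\<^sup>2)" by (simp add: power2_eq_square algebra_simps)
    also have "\<dots> \<le> 1 + b\<^sup>2 + 2 * b * cos (Arg p)" using that(3) p norm_denom_cis by metis
    finally have "2 * b * (1 - cos (Arg p)) \<le> 0" by (simp add: power2_eq_square algebra_simps)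
    then have "1 \<le> cos (Arg p)" using b(1) by (simp add: mult_le_0_iff)
    then have c1: "cos (Arg p) = 1" using cos_le_one[of "Arg p"] by linarith
    then have "sin (Arg p) = 0" using sin_cos_squared_add[of "Arg p"] by simp
    then have "p = 1" using p c1 by (metis complex_eq_iff cis.sel one_complex.sel)
    moreover have "field_map b 1 = 1" using field_map_denom_nonzero[OF b(1) b1, of 1]
      by (simp add: field_map_def add.commute)
    ultimately show ?thesis using that(2) ne by simp
  qed
  then show thesis using fixed_point_dichotomy[OF b(1) b1, of t d] that by blast
qed

text \<open>Take \<open>x = \<bar>Arg p\<bar>\<close>. The derivative bound says that
  \<open>d * field_lift b\<close> has slope at most \<open>1\<close> at \<open>x\<close>, hence on
  all of \<open>[0, x]\<close>, where the cosine is larger. So \<open>x - d * field_lift b x\<close>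
  lies in \<open>[0, pi)\<close> and must equal \<open>\<bar>t\<bar>\<close>. The result is an arc
  of angles invariant under the recursion, with room for one more child.\<close>

lemma circle_neutral_fixed_point:
  assumes b: "0 < b" "b < 1" and d: "2 \<le> d" and t: "- pi < t" "t \<le> pi"
    and p: "norm p = 1" "cis t * field_map b p ^ d = p" "d * (1 - b\<^sup>2) \<le> (norm (1 + of_real b * p))\<^sup>2"
  obtains x where "0 \<le> x" "\<bar>t\<bar> + d * field_lift b x \<le> x" "x + field_lift b x < pi"
proof -
  define x where "x = \<bar>Arg p\<bar>"
  have p_cis: "p = cis (Arg p)" using rcis_cmod_Arg[of p] p(1) by (simp add: rcis_def)
  have cos_x: "cos x = cos (Arg p)" by (simp add: x_def)
  have le: "d * (1 - b\<^sup>2) \<le> 1 + b\<^sup>2 + 2 * b * cos x"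
    using p(3) norm_denom_cis[of b "Arg p"] p_cis cos_x by simp
  have b2: "0 < 1 - b\<^sup>2" using b by (simp add: abs_square_less_1)
  \<comment> \<open>Having at least two children turns the derivative bound into
    \<open>cos x > - b\<close>, the source of the strict inequality in the third conclusion.\<close>
  have "2 * (1 - b\<^sup>2) \<le> d * (1 - b\<^sup>2)" using d b2 by (intro mult_right_mono) auto
  then have "1 - b\<^sup>2 \<le> 2 * b * (b + cos x)" using le by (simp add: power2_eq_square algebra_simps)
  then have "0 < 2 * b * (b + cos x)" using b2 by linarith
  then have cos_gt: "- b < cos x" using b by (simp add: zero_less_mult_iff)
  have x: "0 \<le> x" "x \<le> pi" using Arg_bounded[of p] by (auto simp: x_def abs_le_iff)
  then have "x \<noteq> pi" using cos_gt b by auto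
  then have x_lt: "x < pi" using x by simp
  have "0 - d * field_lift b 0 \<le> x - d * field_lift b x"
  proof (rule DERIV_nonneg_imp_nondecreasing[OF x(1)])
    fix y assume y: "0 \<le> y" "y \<le> x"
    have "cos x \<le> cos y" using y x by (intro cos_monotone_0_pi_le) auto
    then have "2 * b * cos x \<le> 2 * b * cos y" using b by (intro mult_left_mono) auto
    then have "d * (1 - b\<^sup>2) \<le> 1 + b\<^sup>2 + 2 * b * cos y" using le by linarith
    then have "d * ((1 - b\<^sup>2) / (1 + b\<^sup>2 + 2 * b * cos y)) \<le> 1"
      using field_lift_denom_pos[OF b, of y] by (simp add: pos_divide_le_eq)
    then show "\<exists>D. ((\<lambda>x. x - d * field_lift b x) has_real_derivative D) (at y) \<and> 0 \<le> D"
      by (intro exI[of _ "1 - d * ((1 - b\<^sup>2) / (1 + b\<^sup>2 + 2 * b * cos y))"])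
         (auto intro!: derivative_eq_intros field_lift_deriv[OF b])
  qed
  then have u0: "0 \<le> x - d * field_lift b x" using b by simp
  have H0: "0 \<le> field_lift b x" using field_lift_mono[OF b x(1)] b by simp
  have u_pi: "x - d * field_lift b x < pi" using x_lt mult_nonneg_nonneg[OF _ H0, of d] by simp
  define u where "u = Arg p - d * field_lift b (Arg p)"
  have abs_u: "\<bar>u\<bar> = x - d * field_lift b x"
    using u0 field_lift_minus[OF b, of "Arg p"] by (cases "Arg p \<ge> 0") (auto simp: u_def x_def)
  have "cis t * cis (d * field_lift b (Arg p)) = cis (Arg p)"
    using p(2) p_cis by (metis Complex.DeMoivre cis_field_lift[OF b])
  then have "cis t = cis u" unfolding u_def
    by (metis cis_mult add_diff_cancel_right' diff_conv_add_uminus)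
  moreover have "- pi < u" "u \<le> pi" using abs_u u_pi by auto
  ultimately have "t = u" using cis_Arg_unique[of "cis t" t] cis_Arg_unique[of "cis t" u] t
    by (simp add: sgn_cis)
  then have "\<bar>t\<bar> + d * field_lift b x \<le> x" using abs_u by simp
  moreover have "x + field_lift b x < pi"
  proof (rule ccontr)
    assume "\<not> x + field_lift b x < pi"
    then have ge: "pi \<le> x + field_lift b x" by simp
    have "field_lift b x \<le> x"
    proof -
      have "1 * field_lift b x \<le> d * field_lift b x" using d H0 by (intro mult_right_mono) auto
      then show ?thesis using u0 by linarith
    qed
    then have "(x + field_lift b x) / 2 < pi" "pi / 2 \<le> (x + field_lift b x) / 2" using ge x_lt by simp_all
    then have c0: "cos ((x + field_lift b x) / 2) \<le> 0"
      using cos_monotone_0_pi_le[of "pi/2" "(x + field_lift b x) / 2"] by simp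
    define w where "w = 1 + of_real b * cis x"
    \<comment> \<open>The angle \<open>x + v\<close> is half of \<open>x + field_lift b x\<close>,
      and \<open>cis (x + v)\<close> is a positive multiple of \<open>cis x + of_real b\<close>,
      whose real part is positive.\<close>
    define v where "v = Im (Ln (1 + of_real b * cis (- x)))"
    have lift: "field_lift b x = x + 2 * v" by (simp add: field_lift_def disc_lift_def v_def)
    have nz: "1 + of_real b * cis (- x) \<noteq> 0" using field_map_denom_nonzero[OF b] by simp
    have "cis v = sgn (1 + of_real b * cis (- x))"
      unfolding v_def using nz by (metis Arg_eq_Im_Ln cis_Arg)
    then have "cis (x + v) = cis x * sgn (1 + of_real b * cis (- x))" by (simp add: cis_mult[symmetric])
    also have "\<dots> = (cis x * (1 + of_real b * cis (- x))) / of_real (norm (1 + of_real b * cis (- x)))"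
      by (simp add: sgn_eq)
    also have "cis x * (1 + of_real b * cis (- x)) = cis x + of_real b" by (simp add: algebra_simps cis_mult)
    finally have "Re (cis (x + v)) = Re (cis x + of_real b) / norm (1 + of_real b * cis (- x))"
      by (simp only: Re_divide_of_real)
    then have "cos (x + v) = (cos x + b) / norm (1 + of_real b * cis (- x))" by simp
    moreover have "0 < (cos x + b) / norm (1 + of_real b * cis (- x))" using cos_gt nz by (intro divide_pos_pos) auto
    moreover have "(x + field_lift b x) / 2 = x + v" by (simp add: lift)
    ultimately have "0 < cos ((x + field_lift b x) / 2)" by (simp only:)
    then show False using c0 by linarith
  qed
  ultimately show thesis using that x(1) by blast
qed

subsection \<open>Partition functions with vertex-dependent fields\<close>

definition field_weight :: "'a set \<Rightarrow> 'a set set \<Rightarrow> ('a \<Rightarrow> complex) \<Rightarrow> real \<Rightarrow> ('a \<Rightarrow> spin) \<Rightarrow> complex" where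
  "field_weight V E y b \<sigma> = (\<Prod>v\<in>V. if \<sigma> v = Plus then y v else 1) * of_real b ^ cut_size E \<sigma>"

text \<open>Vertex-dependent fields are needed because eliminating a leaf changes the field of its neighbour.\<close>

definition field_Z :: "'a set \<Rightarrow> 'a set set \<Rightarrow> ('a \<Rightarrow> complex) \<Rightarrow> real \<Rightarrow> complex" where
  "field_Z V E y b = (\<Sum>\<sigma>\<in>configs V. field_weight V E y b \<sigma>)"

definition field_Z_at ::
  "'a set \<Rightarrow> 'a set set \<Rightarrow> ('a \<Rightarrow> complex) \<Rightarrow> real \<Rightarrow> 'a \<Rightarrow> spin \<Rightarrow> complex" where
  "field_Z_at V E y b u s = (\<Sum>\<sigma>\<in>{\<sigma>\<in>configs V. \<sigma> u = s}. field_weight V E y b \<sigma>)"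

definition flip :: "spin \<Rightarrow> spin" where
  "flip s = (if s = Plus then Minus else Plus)"

lemma flip_simps [simp]: "flip Plus = Minus" "flip Minus = Plus" "flip (flip s) = s" "flip s = flip s' \<longleftrightarrow> s = s'"
  by (cases s; cases s'; simp add: flip_def)+

lemma spin_UNIV: "{Plus, Minus} = UNIV"
  using spin.exhaust by auto

lemma finite_configs: "finite V \<Longrightarrow> finite (configs V)"
  unfolding configs_def by (intro finite_PiE) auto

lemma ising_weight_eq:
  assumes "finite V"
  shows "ising_weight V E lam b \<sigma> = field_weight V E (\<lambda>_. lam) b \<sigma>"
proof -
  have "(\<Prod>v\<in>V. if \<sigma> v = Plus then lam else 1) = (\<Prod>v\<in>{v\<in>V. \<sigma> v = Plus}. lam)"
    using assms by (intro prod.mono_neutral_cong_right) auto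
  then show ?thesis by (simp add: ising_weight_def field_weight_def n_plus_def)
qed

lemma Z_at_eq: "finite V \<Longrightarrow> Z_at V E u s lam b = field_Z_at V E (\<lambda>_. lam) b u s"
  unfolding Z_at_def field_Z_at_def by (intro sum.cong ising_weight_eq) auto

lemma Z_eq: "finite V \<Longrightarrow> Z V E lam b = field_Z V E (\<lambda>_. lam) b"
  unfolding Z_def field_Z_def by (intro sum.cong ising_weight_eq) auto

lemma sum_by_spin:
  assumes "finite V"
  shows "(\<Sum>\<sigma>\<in>configs V. f \<sigma>) = (\<Sum>\<sigma>\<in>{\<sigma>\<in>configs V. \<sigma> u = s}. f \<sigma>) + (\<Sum>\<sigma>\<in>{\<sigma>\<in>configs V. \<sigma> u = flip s}. f \<sigma>)"
proof -
  have "configs V = {\<sigma>\<in>configs V. \<sigma> u = s} \<union> {\<sigma>\<in>configs V. \<sigma> u = flip s}"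
    by (auto simp: flip_def split: if_splits) (metis spin.exhaust)+
  moreover have "{\<sigma>\<in>configs V. \<sigma> u = s} \<inter> {\<sigma>\<in>configs V. \<sigma> u = flip s} = {}"
    by (cases s) auto
  ultimately show ?thesis
    using finite_configs[OF assms] by (metis (no_types, lifting) finite_Un sum.union_disjoint)
qed

lemma field_Z_split: "finite V \<Longrightarrow> field_Z V E y b = field_Z_at V E y b u Plus + field_Z_at V E y b u Minus"
  unfolding field_Z_def field_Z_at_def using sum_by_spin[of V _ u Plus] by simp

lemma cut_size_cong:
  assumes "simple_graph V E" "\<And>v. v \<in> V \<Longrightarrow> \<sigma> v = \<tau> v"
  shows "cut_size E \<sigma> = cut_size E \<tau>"
proof -
  have "{e \<in> E. \<exists>u v. e = {u, v} \<and> \<sigma> u \<noteq> \<sigma> v} = {e \<in> E. \<exists>u v. e = {u, v} \<and> \<tau> u \<noteq> \<tau> v}"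
    using assms unfolding simple_graph_def by fastforce
  then show ?thesis by (simp add: cut_size_def)
qed

lemma simple_graph_finite: "simple_graph V E \<Longrightarrow> finite V" "simple_graph V E \<Longrightarrow> finite E"
proof -
  assume "simple_graph V E"
  then have "finite V" "E \<subseteq> Pow V" by (auto simp: simple_graph_def)
  then show "finite V" "finite E" using finite_subset by blast+
qed

lemma simple_graph_join:
  assumes "simple_graph V1 E1" "simple_graph V2 E2" "V1 \<inter> V2 = {}" "r1 \<in> V1" "r2 \<in> V2"
  shows "simple_graph (V1 \<union> V2) (insert {r1, r2} (E1 \<union> E2))"
proof -
  have "r1 \<noteq> r2" using assms by auto
  then show ?thesis using assms unfolding simple_graph_def by auto
qed

lemma join_edges_disjoint:
  assumes "simple_graph V1 E1" "simple_graph V2 E2" "V1 \<inter> V2 = {}" "r1 \<in> V1" "r2 \<in> V2"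
  shows "E1 \<inter> E2 = {}" "{r1, r2} \<notin> E1" "{r1, r2} \<notin> E2"
proof -
  show "E1 \<inter> E2 = {}"
  proof (rule ccontr)
    assume "E1 \<inter> E2 \<noteq> {}"
    then obtain e where "e \<in> E1" "e \<in> E2" by blast
    then have "e \<subseteq> V1" "e \<subseteq> V2" "card e = 2" using assms(1,2) by (auto simp: simple_graph_def)
    then have "e = {}" "card e = 2" using assms(3) by auto
    then show False by simp
  qed
  have "e \<subseteq> V1" if "e \<in> E1" for e using that assms(1) by (auto simp: simple_graph_def)
  then show "{r1, r2} \<notin> E1" using assms(3,5) by blast
  have "e \<subseteq> V2" if "e \<in> E2" for e using that assms(2) by (auto simp: simple_graph_def)
  then show "{r1, r2} \<notin> E2" using assms(3,4) by blast
qed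

lemma cut_edge_iff: "(\<exists>u v. {x, y} = {u, v} \<and> \<sigma> u \<noteq> \<sigma> v) \<longleftrightarrow> \<sigma> x \<noteq> \<sigma> y"
  by (auto simp: doubleton_eq_iff)

lemma cut_size_join:
  assumes "simple_graph V1 E1" "simple_graph V2 E2" "V1 \<inter> V2 = {}" "r1 \<in> V1" "r2 \<in> V2"
  shows "cut_size (insert {r1, r2} (E1 \<union> E2)) \<sigma> =
    cut_size E1 \<sigma> + cut_size E2 \<sigma> + (if \<sigma> r1 = \<sigma> r2 then 0 else 1)"
proof -
  let ?C = "\<lambda>E. {e \<in> E. \<exists>u v. e = {u, v} \<and> \<sigma> u \<noteq> \<sigma> v}"
  have fin: "finite (?C E1)" "finite (?C E2)" using simple_graph_finite(2)[OF assms(1)] simple_graph_finite(2)[OF assms(2)] by auto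
  have disj: "?C E1 \<inter> ?C E2 = {}" "{r1, r2} \<notin> ?C E1 \<union> ?C E2" using join_edges_disjoint[OF assms] by auto
  have "?C (insert {r1, r2} (E1 \<union> E2)) = (if \<sigma> r1 = \<sigma> r2 then ?C E1 \<union> ?C E2 else insert {r1, r2} (?C E1 \<union> ?C E2))"
    using cut_edge_iff[of r1 r2 \<sigma>] by auto
  then show ?thesis unfolding cut_size_def using fin disj by (simp add: card_Un_disjoint)
qed

text \<open>Configurations of the joined graph are pairs of configurations coupled only by the new
  edge, which contributes \<open>1\<close> or \<open>b\<close> according to whether
  \<open>r2\<close> has spin \<open>s\<close>. This is the source of the tree recursion.\<close>

lemma field_Z_at_join:
  assumes G: "simple_graph V1 E1" "simple_graph V2 E2" "V1 \<inter> V2 = {}" "r1 \<in> V1" "r2 \<in> V2"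
  shows "field_Z_at (V1 \<union> V2) (insert {r1, r2} (E1 \<union> E2)) y b r1 s =
    field_Z_at V1 E1 y b r1 s * (field_Z_at V2 E2 y b r2 s + of_real b * field_Z_at V2 E2 y b r2 (flip s))"
proof -
  let ?c = "\<lambda>s'. if s = s' then 1 else of_real b :: complex"
  let ?W = "field_weight (V1 \<union> V2) (insert {r1, r2} (E1 \<union> E2)) y b"
  let ?W1 = "field_weight V1 E1 y b" and ?W2 = "field_weight V2 E2 y b"
  let ?A = "{\<sigma>\<in>configs V1. \<sigma> r1 = s}"
  have fin: "finite V1" "finite V2" using simple_graph_finite G by auto
  have "field_Z_at (V1 \<union> V2) (insert {r1, r2} (E1 \<union> E2)) y b r1 s
    = (\<Sum>(\<sigma>1, \<sigma>2)\<in>?A \<times> configs V2. ?W1 \<sigma>1 * (?c (\<sigma>2 r2) * ?W2 \<sigma>2))"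
    unfolding field_Z_at_def
  proof (rule sum.reindex_bij_witness[where i = "\<lambda>(\<sigma>1, \<sigma>2) v. if v \<in> V1 then \<sigma>1 v else \<sigma>2 v"
        and j = "\<lambda>\<sigma>. (restrict \<sigma> V1, restrict \<sigma> V2)"])
    fix \<sigma> assume \<sigma>: "\<sigma> \<in> {\<sigma> \<in> configs (V1 \<union> V2). \<sigma> r1 = s}"
    show "(case (restrict \<sigma> V1, restrict \<sigma> V2) of (\<sigma>1, \<sigma>2) \<Rightarrow> \<lambda>v. if v \<in> V1 then \<sigma>1 v else \<sigma>2 v) = \<sigma>"
      using \<sigma> by (auto simp: configs_def fun_eq_iff restrict_def PiE_def extensional_def)
    show "(restrict \<sigma> V1, restrict \<sigma> V2) \<in> ?A \<times> configs V2"
      using \<sigma> G(4) by (auto simp: configs_def PiE_def)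
    have "?W \<sigma> = ?W1 \<sigma> * (?c (\<sigma> r2) * ?W2 \<sigma>)"
      using \<sigma> unfolding field_weight_def cut_size_join[OF G] prod.union_disjoint[OF fin G(3)]
      by (auto simp: power_add)
    moreover have "?W1 (restrict \<sigma> V1) = ?W1 \<sigma>"
      unfolding field_weight_def cut_size_cong[OF G(1), of "restrict \<sigma> V1" \<sigma>, simplified] by simp
    moreover have "?W2 (restrict \<sigma> V2) = ?W2 \<sigma>"
      unfolding field_weight_def cut_size_cong[OF G(2), of "restrict \<sigma> V2" \<sigma>, simplified] by simp
    ultimately show "(case (restrict \<sigma> V1, restrict \<sigma> V2) of (\<sigma>1, \<sigma>2) \<Rightarrow> ?W1 \<sigma>1 * (?c (\<sigma>2 r2) * ?W2 \<sigma>2)) = ?W \<sigma>"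
      using G(5) by (simp only: prod.case restrict_apply if_True)
  next
    fix p assume "p \<in> ?A \<times> configs V2"
    then obtain \<sigma>1 \<sigma>2 where p: "p = (\<sigma>1, \<sigma>2)" "\<sigma>1 \<in> configs V1" "\<sigma>1 r1 = s" "\<sigma>2 \<in> configs V2" by auto
    then show "(\<lambda>\<sigma>. (restrict \<sigma> V1, restrict \<sigma> V2)) (case p of (\<sigma>1, \<sigma>2) \<Rightarrow> \<lambda>v. if v \<in> V1 then \<sigma>1 v else \<sigma>2 v) = p"
      using G(3) by (auto simp: configs_def fun_eq_iff restrict_def PiE_def extensional_def)
    show "(case p of (\<sigma>1, \<sigma>2) \<Rightarrow> \<lambda>v. if v \<in> V1 then \<sigma>1 v else \<sigma>2 v) \<in> {\<sigma> \<in> configs (V1 \<union> V2). \<sigma> r1 = s}"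
      using p G(4) by (auto simp: configs_def spin_UNIV PiE_def extensional_def)
  qed
  also have "\<dots> = (\<Sum>\<sigma>1\<in>?A. ?W1 \<sigma>1) * (\<Sum>\<sigma>2\<in>configs V2. ?c (\<sigma>2 r2) * ?W2 \<sigma>2)"
    by (simp only: sum_product sum.cartesian_product)
  also have "(\<Sum>\<sigma>2\<in>configs V2. ?c (\<sigma>2 r2) * ?W2 \<sigma>2)
    = (\<Sum>\<sigma>\<in>{\<sigma>\<in>configs V2. \<sigma> r2 = s}. ?W2 \<sigma>) + (\<Sum>\<sigma>\<in>{\<sigma>\<in>configs V2. \<sigma> r2 = flip s}. of_real b * ?W2 \<sigma>)"
    unfolding sum_by_spin[OF fin(2), of _ r2 s]
    by (intro arg_cong2[of _ _ _ _ "(+)"] sum.cong) (auto simp: flip_def)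
  finally show ?thesis by (simp add: field_Z_at_def sum_distrib_left)
qed

lemma field_Z_at_singleton: "field_Z_at {v} {} y b v Plus = y v" "field_Z_at {v} {} y b v Minus = 1"
proof -
  have "{\<sigma> \<in> configs {v}. \<sigma> v = s} = {(\<lambda>x. undefined)(v := s)}" for s
    by (auto simp: configs_def PiE_def extensional_def fun_eq_iff spin_UNIV)
  then show "field_Z_at {v} {} y b v Plus = y v" "field_Z_at {v} {} y b v Minus = 1"
    by (simp_all add: field_Z_at_def field_weight_def cut_size_def)
qed

lemma field_Z_at_update:
  assumes "finite V" "w \<in> V"
  shows "field_Z_at V E (y(w := y w * c)) b w Plus = c * field_Z_at V E y b w Plus"
    and "field_Z_at V E (y(w := y w * c)) b w Minus = field_Z_at V E y b w Minus"
proof -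
  have split: "(\<Prod>v\<in>V. f v) = f w * (\<Prod>v\<in>V - {w}. f v)" for f :: "'a \<Rightarrow> complex"
    by (rule prod.remove[OF assms])
  have rest: "(\<Prod>v\<in>V - {w}. if \<sigma> v = Plus then (y(w := y w * c)) v else 1)
    = (\<Prod>v\<in>V - {w}. if \<sigma> v = Plus then y v else 1)" for \<sigma>
    by (intro prod.cong) auto
  show "field_Z_at V E (y(w := y w * c)) b w Plus = c * field_Z_at V E y b w Plus"
    unfolding field_Z_at_def sum_distrib_left field_weight_def split rest by (intro sum.cong) auto
  show "field_Z_at V E (y(w := y w * c)) b w Minus = field_Z_at V E y b w Minus"
    unfolding field_Z_at_def field_weight_def split rest by (intro sum.cong) auto
qed

text \<open>Summing over the spin of the leaf gives \<open>y v + b\<close> if \<open>w\<close> has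
  spin \<open>Plus\<close> and \<open>1 + b * y v\<close> otherwise; factoring out the latter leaves
  \<open>field_map b (y v)\<close> on the field of \<open>w\<close>.\<close>

lemma field_Z_leaf:
  assumes b: "0 < b" "b < 1" and G: "simple_graph V E" "v \<notin> V" "w \<in> V" and y: "norm (y v) \<le> 1"
  shows "field_Z (insert v V) (insert {v, w} E) y b =
    (1 + of_real b * y v) * field_Z V E (y(w := y w * field_map b (y v))) b"
proof -
  have fin: "finite V" using simple_graph_finite G by auto
  have "simple_graph {v} {}" by (simp add: simple_graph_def)
  note join = field_Z_at_join[OF G(1) this _ G(3), of v y b]
  have eq: "insert v V = V \<union> {v}" "insert {v, w} E = insert {w, v} (E \<union> {})" by auto
  have nz: "1 + of_real b * y v \<noteq> 0" by (rule field_map_denom_nonzero[OF b y])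
  have "field_Z (insert v V) (insert {v, w} E) y b =
    field_Z_at V E y b w Plus * (y v + of_real b) + field_Z_at V E y b w Minus * (1 + of_real b * y v)"
    unfolding field_Z_split[OF finite.insertI[OF fin], of v _ y b w] unfolding eq
    using join G(2) by (simp add: field_Z_at_singleton)
  also have "\<dots> = (1 + of_real b * y v) *
      (field_map b (y v) * field_Z_at V E y b w Plus + field_Z_at V E y b w Minus)"
    using nz by (simp add: field_map_def distrib_left mult.commute)
  also have "\<dots> = (1 + of_real b * y v) * field_Z V E (y(w := y w * field_map b (y v))) b"
    unfolding field_Z_split[OF fin, of _ _ b w] field_Z_at_update[OF fin G(3)] ..
  finally show ?thesis .
qed

lemma field_Z_no_edges:
  assumes "finite V"
  shows "field_Z V {} y b = (\<Prod>v\<in>V. 1 + y v)"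
proof -
  have "(\<Prod>v\<in>V. 1 + y v) = (\<Prod>v\<in>V. \<Sum>s\<in>{Plus, Minus}. if s = Plus then y v else 1)"
    by (intro prod.cong) auto
  also have "\<dots> = (\<Sum>\<sigma>\<in>configs V. \<Prod>v\<in>V. if \<sigma> v = Plus then y v else 1)"
    unfolding configs_def using assms by (intro prod_sum_PiE) auto
  finally show ?thesis by (simp add: field_Z_def field_weight_def cut_size_def)
qed

subsection \<open>Zero-freeness of forests\<close>

lemma other_neighbour:
  assumes G: "simple_graph V E" and xy: "{x, y} \<in> E" and deg: "degree E x \<noteq> 1"
  obtains z where "{x, z} \<in> E" "z \<noteq> x" "z \<noteq> y" "z \<in> V"
proof -
  let ?S = "{e \<in> E. x \<in> e}"
  have "card ?S \<noteq> 1" using deg by (simp only: degree_def not_False_eq_True)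
  then have "?S \<noteq> {{x, y}}" by (metis is_singletonI is_singleton_altdef)
  moreover have "{x, y} \<in> ?S" using xy by simp
  ultimately obtain e where e: "e \<in> E" "x \<in> e" "e \<noteq> {x, y}" by blast
  then have "card e = 2" "e \<subseteq> V" using G by (auto simp: simple_graph_def)
  then obtain u v where "e = {u, v}" "u \<noteq> v" unfolding card_2_iff by blast
  then obtain z where z: "e = {x, z}" "z \<noteq> x" using e(2) by blast
  then show thesis using that[of z] e \<open>e \<subseteq> V\<close> by auto
qed

text \<open>Without vertices of degree one, a path can always be extended at its front by a second
  neighbour, and meeting the path again would close a cycle. So there would be a path with
  \<open>card V + 2\<close> distinct vertices.\<close>

lemma exists_leaf:
  assumes G: "simple_graph V E" and acyclic: "\<nexists>xs. is_cycle E xs" and ne: "E \<noteq> {}"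
  obtains v where "degree E v = 1"
proof (rule ccontr)
  assume "\<not> thesis"
  then have deg: "degree E v \<noteq> 1" for v using that by blast
  have path: "\<exists>x y zs. length zs = n \<and> distinct (x # y # zs) \<and> set (x # y # zs) \<subseteq> V \<and>
      successively (\<lambda>u v. {u, v} \<in> E) (x # y # zs)" for n
  proof (induction n)
    case 0
    obtain e where e: "e \<in> E" using ne by blast
    then have "card e = 2" "e \<subseteq> V" using G by (auto simp: simple_graph_def)
    then obtain x y where "e = {x, y}" "x \<noteq> y" by (auto simp: card_2_iff)
    then show ?case using e \<open>e \<subseteq> V\<close> by (intro exI[of _ x] exI[of _ y]) auto
  next
    case (Suc n)
    then obtain x y zs where p: "length zs = n" "distinct (x # y # zs)" "set (x # y # zs) \<subseteq> V"
      "successively (\<lambda>u v. {u, v} \<in> E) (x # y # zs)" by blast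
    then have "{x, y} \<in> E" by simp
    then obtain z where z: "{x, z} \<in> E" "z \<noteq> x" "z \<noteq> y" "z \<in> V"
      using other_neighbour[OF G _ deg] by blast
    have "z \<notin> set zs"
    proof
      assume "z \<in> set zs"
      then obtain as bs where zs: "zs = as @ z # bs" by (meson split_list)
      have "successively (\<lambda>u v. {u, v} \<in> E) ((x # y # as @ [z]) @ bs)" using p(4) by (simp add: zs)
      then have "successively (\<lambda>u v. {u, v} \<in> E) (x # y # as @ [z])"
        unfolding successively_append_iff by blast
      then have "is_cycle E (x # y # as @ [z])"
        unfolding is_cycle_def using p(2) z(1) by (auto simp: zs insert_commute)
      then show False using acyclic by blast
    qed
    then show ?case using p z
      by (intro exI[of _ z] exI[of _ x] exI[of _ "y # zs"]) (auto simp: insert_commute)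
  qed
  have fin: "finite V" using simple_graph_finite(1)[OF G] .
  obtain x y zs where p: "length zs = card V" "distinct (x # y # zs)" "set (x # y # zs) \<subseteq> V"
    using path[of "card V"] by blast
  have "length (x # y # zs) \<le> card V"
    using card_mono[OF fin p(3)] distinct_card[OF p(2)] by simp
  then show False using p(1) by simp
qed

lemma is_cycle_mono: "is_cycle E xs \<Longrightarrow> E \<subseteq> E' \<Longrightarrow> is_cycle E' xs"
  unfolding is_cycle_def by (auto intro: successively_mono)

lemma one_plus_cis_nonzero:
  assumes "\<bar>\<phi>\<bar> < pi"
  shows "1 + cis \<phi> \<noteq> 0"
proof
  assume "1 + cis \<phi> = 0"
  then have "cos \<phi> = - 1" by (simp add: complex_eq_iff)
  moreover have "cos pi < cos \<bar>\<phi>\<bar>" using assms by (intro cos_monotone_0_pi) auto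
  ultimately show False by simp
qed

text \<open>A leaf with angle at most \<open>x\<close> turns the field of its neighbour by at most \<open>field_lift b x\<close>
  when it is eliminated. A vertex of original degree \<open>k\<close> that has itself become a leaf has absorbed
  \<open>k - 1 \<le> d\<close> such turns.\<close>

lemma forest_field_Z_nonzero:
  assumes b: "0 < b" "b < 1"
    and x: "0 \<le> x" "s + d * field_lift b x \<le> x" "x + field_lift b x < pi"
    and G: "simple_graph V E" "\<nexists>xs. is_cycle E xs"
    and angles: "\<And>v. v \<in> V \<Longrightarrow> degree E v \<le> d + 1 \<and> y v = cis (\<phi> v) \<and>
      \<bar>\<phi> v\<bar> \<le> s + (real (d + 1) - degree E v) * field_lift b x"
  shows "field_Z V E y b \<noteq> 0"
  using G angles
proof (induction "card E" arbitrary: V E y \<phi>)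
  case 0
  then have fin: "finite V" "E = {}" using simple_graph_finite[OF 0(2)] by auto
  have "1 + y v \<noteq> 0" if "v \<in> V" for v
  proof -
    have "\<bar>\<phi> v\<bar> \<le> s + real (d + 1) * field_lift b x" "y v = cis (\<phi> v)"
      using 0(4)[OF that] by (auto simp: fin(2) degree_def)
    \<comment> \<open>An isolated vertex has angle at most \<open>s + d * field_lift b x\<close>
      plus one more turn, hence at most \<open>x + field_lift b x\<close>.\<close>
    then have "\<bar>\<phi> v\<bar> < pi" using x(2,3) by (simp add: distrib_right)
    then show ?thesis using one_plus_cis_nonzero \<open>y v = cis (\<phi> v)\<close> by simp
  qed
  then show ?case using fin by (simp add: field_Z_no_edges)
next
  case (Suc n)
  have fin: "finite V" "finite E" using simple_graph_finite[OF Suc(3)] by auto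
  have "E \<noteq> {}" using Suc(2) by auto
  then obtain v where v: "degree E v = 1" using exists_leaf[OF Suc(3,4)] by blast
  then obtain e where e: "{e \<in> E. v \<in> e} = {e}" unfolding degree_def by (auto simp: card_1_singleton_iff)
  then have eE: "e \<in> E" "v \<in> e" by auto
  then have "card e = 2" "e \<subseteq> V" using Suc(3) by (auto simp: simple_graph_def)
  then obtain u u' where "e = {u, u'}" "u \<noteq> u'" unfolding card_2_iff by blast
  then obtain w where w: "e = {v, w}" "w \<noteq> v" using eE(2) by blast
  have vw: "v \<in> V" "w \<in> V" using \<open>e \<subseteq> V\<close> w by auto
  define E' where "E' = E - {e}"
  define V' where "V' = V - {v}"
  have E: "E = insert {v, w} E'" and V: "V = insert v V'" using eE(1) w(1) vw(1) by (auto simp: E'_def V'_def)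
  have G': "simple_graph V' E'"
    unfolding simple_graph_def
  proof (intro conjI ballI)
    fix e' assume e': "e' \<in> E'"
    then have "e' \<in> E" "e' \<noteq> e" by (auto simp: E'_def)
    moreover from this have "v \<notin> e'" using e by blast
    ultimately show "e' \<subseteq> V'" "card e' = 2" using Suc(3) by (auto simp: simple_graph_def V'_def)
  qed (use fin in \<open>simp add: V'_def\<close>)
  have acyclic': "\<nexists>xs. is_cycle E' xs" using Suc(4) is_cycle_mono[of E' _ E] by (auto simp: E'_def)
  define \<phi>' where "\<phi>' = \<phi>(w := \<phi> w + field_lift b (\<phi> v))"
  define y' where "y' = y(w := y w * field_map b (y v))"
  have deg_w: "degree E w = Suc (degree E' w)"
  proof -
    have "{e \<in> E. w \<in> e} = insert e {e \<in> E'. w \<in> e}" using eE(1) w by (auto simp: E'_def)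
    then show ?thesis using fin by (simp add: degree_def E'_def)
  qed
  have deg_u: "degree E u = degree E' u" if "u \<noteq> v" "u \<noteq> w" for u
  proof -
    have "{e \<in> E. u \<in> e} = {e \<in> E'. u \<in> e}" using w(1) that by (auto simp: E'_def)
    then show ?thesis by (simp add: degree_def)
  qed
  \<comment> \<open>Degree one leaves at most \<open>d\<close> turns in the bound for the
    leaf.\<close>
  have "\<bar>\<phi> v\<bar> \<le> x" using Suc(5)[OF vw(1)] x(2) v by simp
  then have "field_lift b (\<phi> v) \<le> field_lift b x" "field_lift b (- x) \<le> field_lift b (\<phi> v)"
    by (intro field_lift_mono[OF b]; simp add: abs_le_iff)+
  then have turn: "\<bar>field_lift b (\<phi> v)\<bar> \<le> field_lift b x" using field_lift_minus[OF b] by simp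
  have "field_Z V' E' y' b \<noteq> 0"
  proof (rule Suc(1)[OF _ G' acyclic'])
    show "n = card E'" using Suc(2) eE(1) fin by (simp add: E'_def)
    fix u assume "u \<in> V'"
    then have u: "u \<in> V" "u \<noteq> v" by (auto simp: V'_def)
    show "degree E' u \<le> d + 1 \<and> y' u = cis (\<phi>' u) \<and>
      \<bar>\<phi>' u\<bar> \<le> s + (real (d + 1) - degree E' u) * field_lift b x"
    proof (cases "u = w")
      case True
      have "y' w = cis (\<phi>' w)"
        using Suc(5)[OF vw(1)] Suc(5)[OF vw(2)] cis_field_lift[OF b, of "\<phi> v"]
        by (simp add: y'_def \<phi>'_def cis_mult[symmetric])
      moreover have "\<bar>\<phi> w\<bar> \<le> s + (real (d + 1) - degree E w) * field_lift b x"
        using Suc(5)[OF vw(2)] by simp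
      then have "\<bar>\<phi>' w\<bar> \<le> s + (real (d + 1) - degree E' w) * field_lift b x"
        using turn by (simp add: \<phi>'_def deg_w algebra_simps)
      moreover have "degree E' w \<le> d + 1" using Suc(5)[OF vw(2)] deg_w by simp
      ultimately show ?thesis using True by simp
    next
      case False
      then show ?thesis using Suc(5)[OF u(1)] deg_u[OF u(2) False] by (simp add: y'_def \<phi>'_def)
    qed
  qed
  moreover have norm_v: "norm (y v) \<le> 1" using Suc(5)[OF vw(1)] by simp
  moreover have "v \<notin> V'" "w \<in> V'" using vw w by (auto simp: V'_def)
  ultimately show ?case
    using field_Z_leaf[OF b G', of v w y] field_map_denom_nonzero[OF b norm_v]
    by (simp add: E[symmetric] V[symmetric] y'_def)
qed

lemma degree_le_max_degree: "finite V \<Longrightarrow> v \<in> V \<Longrightarrow> degree E v \<le> max_degree V E"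
  unfolding max_degree_def by (intro Max_ge) auto

lemma max_degree_le_iff: "finite V \<Longrightarrow> max_degree V E \<le> k \<longleftrightarrow> (\<forall>v\<in>V. degree E v \<le> k)"
  unfolding max_degree_def by (subst Max_le_iff) auto

lemma tree_Z_nonzero:
  assumes b: "0 < b" "b < 1"
    and x: "0 \<le> x" "s + d * field_lift b x \<le> x" "x + field_lift b x < pi"
    and G: "simple_graph V E" "\<nexists>xs. is_cycle E xs" "max_degree V E \<le> d + 1" and t: "\<bar>t\<bar> \<le> s"
  shows "Z V E (cis t) b \<noteq> 0"
proof -
  have fin: "finite V" using simple_graph_finite(1)[OF G(1)] .
  have H0: "0 \<le> field_lift b x" using field_lift_mono[OF b x(1)] b by simp
  have "field_Z V E (\<lambda>_. cis t) b \<noteq> 0"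
  proof (rule forest_field_Z_nonzero[OF b x G(1,2), where \<phi> = "\<lambda>_. t"])
    fix v assume "v \<in> V"
    then have deg: "degree E v \<le> d + 1" using degree_le_max_degree[OF fin] G(3) order_trans by blast
    then have "0 \<le> (real (d + 1) - degree E v) * field_lift b x" using H0 by (intro mult_nonneg_nonneg) auto
    then show "degree E v \<le> d + 1 \<and> cis t = cis t \<and> \<bar>t\<bar> \<le> s + (real (d + 1) - degree E v) * field_lift b x"
      using deg t by simp
  qed
  then show ?thesis using fin by (simp add: Z_eq)
qed

subsection \<open>Construction of trees\<close>

text \<open>Trees on an interval \<open>{N..<M}\<close> of vertices with root \<open>N\<close> of degree \<open>k\<close>, in which every vertex
  has at most one smaller neighbour. The interval may start anywhere, so that no relabelling is
  needed when two trees are joined.\<close>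

inductive interval_tree :: "nat \<Rightarrow> nat \<Rightarrow> nat \<Rightarrow> nat set set \<Rightarrow> nat \<Rightarrow> bool" for d where
  single: "interval_tree d N (Suc N) {} 0"
| join: "interval_tree d N M E1 k \<Longrightarrow> k < d \<Longrightarrow> interval_tree d M L E2 j \<Longrightarrow>
    interval_tree d N L (insert {N, M} (E1 \<union> E2)) (Suc k)"

lemma interval_tree_less: "interval_tree d N M E k \<Longrightarrow> N < M"
  by (induction rule: interval_tree.induct) auto

lemma interval_tree_root_degree_le: "interval_tree d N M E k \<Longrightarrow> k \<le> d"
  by (induction rule: interval_tree.induct) auto

lemma interval_split: "N < M \<Longrightarrow> M < L \<Longrightarrow> {N..<L} = {N..<M} \<union> {M..<L :: nat}"
  by auto

lemma interval_tree_simple: "interval_tree d N M E k \<Longrightarrow> simple_graph {N..<M} E"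
proof (induction rule: interval_tree.induct)
  case (join N M E1 k L E2 j)
  then have less: "N < M" "M < L" using interval_tree_less by auto
  show ?case unfolding interval_split[OF less]
    using join.IH less by (intro simple_graph_join) auto
qed (simp add: simple_graph_def)

lemma degree_join:
  assumes G: "simple_graph V1 E1" "simple_graph V2 E2" "V1 \<inter> V2 = {}" "r1 \<in> V1" "r2 \<in> V2"
    and v: "v \<in> V1"
  shows "degree (insert {r1, r2} (E1 \<union> E2)) v = degree E1 v + (if v = r1 then 1 else 0)"
proof -
  have "v \<notin> e" if "e \<in> E2" for e using that G(2,3) v by (auto simp: simple_graph_def)
  moreover have "v \<noteq> r2" using G(3,5) v by auto
  ultimately have "{e \<in> insert {r1, r2} (E1 \<union> E2). v \<in> e} =
    (if v = r1 then insert {r1, r2} {e \<in> E1. v \<in> e} else {e \<in> E1. v \<in> e})" by auto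
  then show ?thesis
    using simple_graph_finite(2)[OF G(1)] join_edges_disjoint(2)[OF G(1-5)] by (simp add: degree_def)
qed

lemma degree_join':
  assumes G: "simple_graph V1 E1" "simple_graph V2 E2" "V1 \<inter> V2 = {}" "r1 \<in> V1" "r2 \<in> V2"
    and v: "v \<in> V2"
  shows "degree (insert {r1, r2} (E1 \<union> E2)) v = degree E2 v + (if v = r2 then 1 else 0)"
  using degree_join[OF G(2,1) _ G(5,4) v] G(3) by (simp add: Int_commute Un_commute insert_commute)

lemma interval_tree_degrees:
  "interval_tree d N M E k \<Longrightarrow> degree E N = k \<and> (\<forall>v\<in>{N..<M}. degree E v \<le> d + 1)"
proof (induction rule: interval_tree.induct)
  case (join N M E1 k L E2 j)
  then have less: "N < M" "M < L" using interval_tree_less by auto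
  note G = interval_tree_simple[OF join(1)] interval_tree_simple[OF join(3)]
  have disj: "{N..<M} \<inter> {M..<L} = {}" by auto
  have roots: "N \<in> {N..<M}" "M \<in> {M..<L}" using less by auto
  have "j \<le> d" by (rule interval_tree_root_degree_le[OF join(3)])
  show ?case
  proof (intro conjI ballI)
    show "degree (insert {N, M} (E1 \<union> E2)) N = Suc k"
      using degree_join[OF G disj roots roots(1)] join.IH by simp
    fix v assume "v \<in> {N..<L}"
    then consider "v \<in> {N..<M}" | "v \<in> {M..<L}" by fastforce
    then show "degree (insert {N, M} (E1 \<union> E2)) v \<le> d + 1"
    proof cases
      case 1
      then show ?thesis using degree_join[OF G disj roots 1] join.IH join.hyps by auto
    next
      case 2
      then show ?thesis using degree_join'[OF G disj roots 2] join.IH \<open>j \<le> d\<close> by auto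
    qed
  qed
qed (simp add: degree_def)

lemma adjacency_mono: "E \<subseteq> E' \<Longrightarrow> (adjacency E)\<^sup>* \<subseteq> (adjacency E')\<^sup>*"
  by (rule rtrancl_mono) (auto simp: adjacency_def)

lemma interval_tree_reachable: "interval_tree d N M E k \<Longrightarrow> \<forall>v\<in>{N..<M}. (N, v) \<in> (adjacency E)\<^sup>*"
proof (induction rule: interval_tree.induct)
  case (join N M E1 k L E2 j)
  let ?E = "insert {N, M} (E1 \<union> E2)"
  have NM: "(N, M) \<in> (adjacency ?E)\<^sup>*" by (rule r_into_rtrancl) (simp add: adjacency_def)
  have sub: "(adjacency E1)\<^sup>* \<subseteq> (adjacency ?E)\<^sup>*" "(adjacency E2)\<^sup>* \<subseteq> (adjacency ?E)\<^sup>*"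
    by (intro adjacency_mono; blast)+
  show ?case
  proof
    fix v assume v: "v \<in> {N..<L}"
    show "(N, v) \<in> (adjacency ?E)\<^sup>*"
    proof (cases "v < M")
      case True
      then have "(N, v) \<in> (adjacency E1)\<^sup>*" using join.IH(1) v by simp
      then show ?thesis using sub(1) by blast
    next
      case False
      then have "(M, v) \<in> (adjacency E2)\<^sup>*" using join.IH(2) v by simp
      then show ?thesis using NM sub(2) by (meson rtrancl_trans subsetD)
    qed
  qed
qed simp

lemma interval_tree_connected:
  assumes "interval_tree d N M E k"
  shows "connected_graph {N..<M} E"
proof -
  have "sym ((adjacency E)\<^sup>*)" by (rule sym_rtrancl) (simp add: sym_def adjacency_def insert_commute)
  then have "(u, v) \<in> (adjacency E)\<^sup>*" if "u \<in> {N..<M}" "v \<in> {N..<M}" for u v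
    using interval_tree_reachable[OF assms] that by (meson rtrancl_trans symD)
  then show ?thesis using interval_tree_less[OF assms] by (auto simp: connected_graph_def)
qed

text \<open>The new edge is the only one between the two blocks, and \<open>M\<close> is the
  smallest vertex of its own block, so \<open>N\<close> becomes the unique smaller neighbour of
  \<open>M\<close>.\<close>

lemma interval_tree_smaller_neighbour:
  "interval_tree d N M E k \<Longrightarrow> {u, w} \<in> E \<Longrightarrow> {v, w} \<in> E \<Longrightarrow> u < w \<Longrightarrow> v < w \<Longrightarrow> u = v"
proof (induction arbitrary: u v w rule: interval_tree.induct)
  case (join N M E1 k L E2 j)
  have E1: "a \<in> {N..<M} \<and> c \<in> {N..<M}" if "{a, c} \<in> E1" for a c
    using interval_tree_simple[OF join(1)] that by (auto simp: simple_graph_def)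
  have E2: "a \<in> {M..<L} \<and> c \<in> {M..<L}" if "{a, c} \<in> E2" for a c
    using interval_tree_simple[OF join(3)] that by (auto simp: simple_graph_def)
  have less: "N < M" using interval_tree_less[OF join(1)] .
  show ?case
  proof (cases "w < M")
    case True
    have "{a, w} \<in> E1" if "{a, w} \<in> insert {N, M} (E1 \<union> E2)" "a < w" for a
      using that E2[of a w] True by (auto simp: doubleton_eq_iff)
    then show ?thesis using join.IH(1) join.prems by blast
  next
    case False
    show ?thesis
    proof (cases "w = M")
      case True
      have "a = N" if "{a, w} \<in> insert {N, M} (E1 \<union> E2)" "a < w" for a
        using that E1[of a w] E2[of a w] True by (auto simp: doubleton_eq_iff)
      then show ?thesis using join.prems by blast
    next
      case neq: False
      have "{a, w} \<in> E2" if "{a, w} \<in> insert {N, M} (E1 \<union> E2)" "a < w" for a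
        using that E1[of a w] False neq less by (auto simp: doubleton_eq_iff)
      then show ?thesis using join.IH(2) join.prems by blast
    qed
  qed
qed simp

text \<open>The largest vertex of a cycle would have two smaller neighbours.\<close>

lemma acyclic_of_smaller_neighbours:
  fixes E :: "'a::linorder set set"
  assumes "\<And>u v w. {u, w} \<in> E \<Longrightarrow> {v, w} \<in> E \<Longrightarrow> u < w \<Longrightarrow> v < w \<Longrightarrow> u = v"
  shows "\<not> is_cycle E xs"
proof
  assume c: "is_cycle E xs"
  define n where "n = length xs"
  have n: "3 \<le> n" and dist: "distinct xs" using c by (auto simp: is_cycle_def n_def)
  have edge: "{xs ! i, xs ! (Suc i mod n)} \<in> E" if "i < n" for i
  proof (cases "Suc i = n")
    case True
    then have "i = n - 1" by simp
    moreover have "last xs = xs ! (n - 1)" "hd xs = xs ! 0" 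
      using n by (auto simp: n_def last_conv_nth hd_conv_nth simp flip: length_0_conv)
    ultimately show ?thesis using c True by (simp add: is_cycle_def)
  next
    case False
    then show ?thesis using c that by (auto simp: is_cycle_def successively_conv_nth n_def)
  qed
  have "set xs \<noteq> {}" using n by (auto simp: n_def)
  then have "Max (set xs) \<in> set xs" by simp
  then obtain i where i: "i < n" "xs ! i = Max (set xs)" by (auto simp: in_set_conv_nth n_def)
  \<comment> \<open>The cyclic predecessor \<open>j\<close> and successor \<open>k\<close> of the
    position \<open>i\<close> of the maximum; they are different because the length is at least
    \<open>3\<close>.\<close>
  define j where "j = (if i = 0 then n - 1 else i - 1)"
  define k where "k = (if Suc i = n then 0 else Suc i)"
  have jk: "j < n" "k < n" "j \<noteq> i" "k \<noteq> i" "j \<noteq> k" "Suc j mod n = i" "Suc i mod n = k"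
    using i(1) n by (auto simp: j_def k_def)
  have less: "xs ! m < xs ! i" if "m < n" "m \<noteq> i" for m
  proof -
    have "xs ! m \<le> xs ! i" unfolding i(2) using that by (intro Max_ge) (auto simp: n_def)
    moreover have "xs ! m \<noteq> xs ! i" using that i(1) dist by (simp add: n_def nth_eq_iff_index_eq)
    ultimately show ?thesis by simp
  qed
  have "xs ! j < xs ! i" "xs ! k < xs ! i" using less jk by simp_all
  moreover have "{xs ! j, xs ! i} \<in> E" "{xs ! k, xs ! i} \<in> E"
    using edge[OF jk(1)] edge[OF i(1)] jk by (simp_all add: insert_commute)
  ultimately have "xs ! j = xs ! k" using assms by blast
  then show False using dist jk by (simp add: n_def nth_eq_iff_index_eq)
qed

lemma interval_tree_rooted_tree:
  assumes "interval_tree d N M E k"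
  shows "({N..<M}, E, N) \<in> rooted_trees d"
proof -
  have "\<nexists>xs. is_cycle E xs"
    using acyclic_of_smaller_neighbours interval_tree_smaller_neighbour[OF assms] by blast
  then have "tree {N..<M} E"
    using interval_tree_simple[OF assms] interval_tree_connected[OF assms] by (simp add: tree_def)
  moreover have "max_degree {N..<M} E \<le> d + 1"
    using interval_tree_degrees[OF assms] by (simp add: max_degree_le_iff)
  moreover have "N \<in> {N..<M}" using interval_tree_less[OF assms] by simp
  ultimately show ?thesis
    using interval_tree_degrees[OF assms] interval_tree_root_degree_le[OF assms]
    by (simp add: rooted_trees_def)
qed

text \<open>Flipping all spins preserves the cut and replaces \<open>n_plus\<close> by its
  complement; on the circle, where \<open>cnj lam\<close> is the inverse of \<open>lam\<close>, this
  is conjugation up to the factor \<open>lam ^ card V\<close>. Hence implemented fields have norm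
  \<open>1\<close>.\<close>

lemma Z_at_Plus_eq_cnj:
  assumes V: "finite V" and G: "simple_graph V E" "r \<in> V" and lam: "norm lam = 1"
  shows "Z_at V E r Plus lam b = lam ^ card V * cnj (Z_at V E r Minus lam b)"
proof -
  let ?f = "\<lambda>\<sigma> v. if v \<in> V then flip (\<sigma> v) else undefined"
  have inv: "lam * cnj lam = 1" using lam complex_norm_square[of lam] by simp
  have "Z_at V E r Plus lam b = (\<Sum>\<sigma>\<in>{\<sigma> \<in> configs V. \<sigma> r = Minus}. lam ^ card V * cnj (ising_weight V E lam b \<sigma>))"
    unfolding Z_at_def
  proof (rule sum.reindex_bij_witness[where i = ?f and j = ?f])
    fix \<sigma> assume \<sigma>: "\<sigma> \<in> {\<sigma> \<in> configs V. \<sigma> r = Plus}"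
    show "?f (?f \<sigma>) = \<sigma>" using \<sigma> by (auto simp: configs_def PiE_def extensional_def)
    show "?f \<sigma> \<in> {\<sigma> \<in> configs V. \<sigma> r = Minus}" using \<sigma> G(2) by (auto simp: configs_def spin_UNIV)
    have "{v \<in> V. ?f \<sigma> v = Plus} = V - {v \<in> V. \<sigma> v = Plus}"
      by (auto simp: flip_def split: if_splits)
    then have n: "n_plus V (?f \<sigma>) = card V - n_plus V \<sigma>" unfolding n_plus_def using V by (simp add: card_Diff_subset)
    have "n_plus V \<sigma> \<le> card V" unfolding n_plus_def using V by (intro card_mono) auto
    then have "lam ^ card V * cnj lam ^ (card V - n_plus V \<sigma>) = lam ^ n_plus V \<sigma> * (lam * cnj lam) ^ (card V - n_plus V \<sigma>)"
      by (simp add: power_mult_distrib power_add[symmetric] mult.assoc[symmetric])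
    then have pow: "lam ^ card V * cnj lam ^ (card V - n_plus V \<sigma>) = lam ^ n_plus V \<sigma>" by (simp add: inv)
    have cut: "cut_size E (?f \<sigma>) = cut_size E \<sigma>"
    proof -
      have "(\<exists>u v. e = {u, v} \<and> ?f \<sigma> u \<noteq> ?f \<sigma> v) \<longleftrightarrow> (\<exists>u v. e = {u, v} \<and> \<sigma> u \<noteq> \<sigma> v)" if e: "e \<in> E" for e
      proof -
        have "card e = 2" "e \<subseteq> V" using e G(1) by (auto simp: simple_graph_def)
        then obtain x y where xy: "e = {x, y}" "x \<in> V" "y \<in> V" unfolding card_2_iff by blast
        show ?thesis unfolding xy(1) cut_edge_iff using xy(2,3) by simp
      qed
      then show ?thesis by (simp add: cut_size_def cong: conj_cong)
    qed
    show "lam ^ card V * cnj (ising_weight V E lam b (?f \<sigma>)) = ising_weight V E lam b \<sigma>"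
      by (simp add: ising_weight_def n cut mult.assoc[symmetric] pow)
  next
    fix \<sigma> assume \<sigma>: "\<sigma> \<in> {\<sigma> \<in> configs V. \<sigma> r = Minus}"
    show "?f (?f \<sigma>) = \<sigma>" using \<sigma> by (auto simp: configs_def PiE_def extensional_def)
    show "?f \<sigma> \<in> {\<sigma> \<in> configs V. \<sigma> r = Plus}" using \<sigma> G(2) by (auto simp: configs_def spin_UNIV)
  qed
  then show ?thesis by (simp add: Z_at_def sum_distrib_left)
qed

lemma norm_implemented_field:
  assumes "simple_graph V E" "r \<in> V" "norm lam = 1" "implements_field V E r lam b \<xi>"
  shows "norm \<xi> = 1"
  using Z_at_Plus_eq_cnj[OF simple_graph_finite(1)[OF assms(1)] assms(1-3), of b] assms(3,4)
  by (simp add: implements_field_def norm_mult norm_divide norm_power)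

text \<open>Asking for a tree from every start \<open>N\<close> lets a second tree begin exactly
  where the first one ends. The index \<open>k\<close> is the root degree, which limits further
  joins.\<close>

definition tree_fields :: "nat \<Rightarrow> complex \<Rightarrow> real \<Rightarrow> nat \<Rightarrow> complex set" where
  "tree_fields d lam b k =
    {\<xi>. \<forall>N. \<exists>M E. interval_tree d N M E k \<and> implements_field {N..<M} E N lam b \<xi>}"

lemma norm_tree_fields:
  assumes "norm lam = 1" "\<xi> \<in> tree_fields d lam b k"
  shows "norm \<xi> = 1"
proof -
  obtain M E where T: "interval_tree d 0 M E k" "implements_field {0..<M} E 0 lam b \<xi>"
    using assms(2) unfolding tree_fields_def by blast
  then show ?thesis
    using norm_implemented_field[OF interval_tree_simple[OF T(1)] _ assms(1) T(2)] interval_tree_less[OF T(1)] by simp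
qed

lemma tree_fields_single: "lam \<in> tree_fields d lam b 0"
proof -
  have "implements_field {N..<Suc N} {} N lam b lam" for N :: nat
    unfolding atLeastLessThan_singleton
    using field_Z_at_singleton[of N "\<lambda>_. lam" b] by (simp add: implements_field_def Z_at_eq)
  then show ?thesis unfolding tree_fields_def using interval_tree.single by blast
qed

lemma tree_fields_join:
  assumes b: "0 < b" "b < 1" and lam: "norm lam = 1"
    and \<xi>: "\<xi> \<in> tree_fields d lam b k" "k < d" "\<zeta> \<in> tree_fields d lam b j"
  shows "\<xi> * field_map b \<zeta> \<in> tree_fields d lam b (Suc k)"
  unfolding tree_fields_def
proof (intro CollectI allI)
  fix N
  obtain M E1 where T1: "interval_tree d N M E1 k" "implements_field {N..<M} E1 N lam b \<xi>"
    using \<xi>(1) unfolding tree_fields_def by blast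
  obtain L E2 where T2: "interval_tree d M L E2 j" "implements_field {M..<L} E2 M lam b \<zeta>"
    using \<xi>(3) unfolding tree_fields_def by blast
  have less: "N < M" "M < L" using interval_tree_less T1(1) T2(1) by auto
  let ?E = "insert {N, M} (E1 \<union> E2)"
  let ?A = "Z_at {N..<M} E1 N" and ?B = "Z_at {M..<L} E2 M"
  have Z: "Z_at {N..<L} ?E N s lam b = ?A s lam b * (?B s lam b + of_real b * ?B (flip s) lam b)" for s
    unfolding interval_split[OF less] using less
    by (simp add: Z_at_eq field_Z_at_join[OF interval_tree_simple[OF T1(1)] interval_tree_simple[OF T2(1)]])
  have nz: "?A Minus lam b \<noteq> 0" "?B Minus lam b \<noteq> 0"
    and plus: "?A Plus lam b = \<xi> * ?A Minus lam b" "?B Plus lam b = \<zeta> * ?B Minus lam b"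
    using T1(2) T2(2) by (auto simp: implements_field_def)
  have nz': "1 + of_real b * \<zeta> \<noteq> 0"
    using field_map_denom_nonzero[OF b] norm_tree_fields[OF lam \<xi>(3)] by simp
  have minus: "Z_at {N..<L} ?E N Minus lam b = ?A Minus lam b * ?B Minus lam b * (1 + of_real b * \<zeta>)"
    unfolding Z by (simp add: plus algebra_simps)
  have "Z_at {N..<L} ?E N Plus lam b = ?A Minus lam b * ?B Minus lam b * (\<xi> * (\<zeta> + of_real b))"
    unfolding Z by (simp add: plus algebra_simps)
  then have "implements_field {N..<L} ?E N lam b (\<xi> * field_map b \<zeta>)"
    unfolding implements_field_def minus using nz nz' by (simp add: field_map_def)
  moreover have "interval_tree d N L ?E (Suc k)" by (rule interval_tree.join[OF T1(1) \<xi>(2) T2(1)])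
  ultimately show "\<exists>M E. interval_tree d N M E (Suc k) \<and> implements_field {N..<M} E N lam b (\<xi> * field_map b \<zeta>)"
    by blast
qed

lemma tree_fields_leaf_rooted: "tree_fields d lam b 1 \<subseteq> leaf_rooted_fields d lam b"
proof
  fix \<xi> assume "\<xi> \<in> tree_fields d lam b 1"
  then obtain M E where T: "interval_tree d 0 M E 1" "implements_field {0..<M} E 0 lam b \<xi>"
    unfolding tree_fields_def by blast
  then show "\<xi> \<in> leaf_rooted_fields d lam b"
    unfolding leaf_rooted_fields_def using interval_tree_rooted_tree[OF T(1)] interval_tree_degrees[OF T(1)] by blast
qed

subsection \<open>Fields of leaf-rooted trees\<close>

lemma circle_cis_Arg: "z \<in> unit_circle \<Longrightarrow> cis (Arg z) = z"
  using rcis_cmod_Arg[of z] by (simp add: unit_circle_def rcis_def)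

lemma leaf_rooted_fields_subset:
  assumes "norm lam = 1"
  shows "leaf_rooted_fields d lam b \<subseteq> unit_circle"
  using norm_implemented_field[OF _ _ assms]
  by (auto simp: leaf_rooted_fields_def rooted_trees_def tree_def unit_circle_def)

lemma leaf_rooted_fieldsE:
  assumes "\<xi> \<in> leaf_rooted_fields d lam b"
  obtains V :: "nat set" and E r where "simple_graph V E" "max_degree V E \<le> d + 1" "r \<in> V" "degree E r \<le> d"
    "implements_field V E r lam b \<xi>"
proof -
  from assms obtain V E r where "(V, E, r) \<in> rooted_trees d" "implements_field V E r lam b \<xi>"
    unfolding leaf_rooted_fields_def by blast
  then show thesis using that[of V E r] by (simp add: rooted_trees_def tree_def)
qed

lemma field_map_surj_circle:
  assumes b: "0 < b" "b < 1" and u: "norm u = 1"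
  obtains z where "norm z = 1" "field_map b z = u"
proof -
  define z where "z = (u - of_real b) / (1 - of_real b * u)"
  have nz: "1 - of_real b * u \<noteq> 0" using field_map_denom_nonzero[OF b, of "- u"] u by simp
  have sq: "(Re u)\<^sup>2 + (Im u)\<^sup>2 = 1" using u by (simp add: cmod_power2[symmetric])
  have "(norm (u - of_real b))\<^sup>2 = ((Re u)\<^sup>2 + (Im u)\<^sup>2) + b\<^sup>2 - 2 * b * Re u"
    unfolding cmod_power2 by (simp add: power2_eq_square algebra_simps)
  moreover have "(norm (1 - of_real b * u))\<^sup>2 = 1 + b\<^sup>2 * ((Re u)\<^sup>2 + (Im u)\<^sup>2) - 2 * b * Re u"
    unfolding cmod_power2 by (simp add: power2_eq_square algebra_simps)
  ultimately have "(norm (u - of_real b))\<^sup>2 = (norm (1 - of_real b * u))\<^sup>2" by (simp add: sq)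
  then have norm_eq: "norm (u - of_real b) = norm (1 - of_real b * u)" by simp
  then have "norm z = 1" using nz by (simp add: z_def norm_divide)
  have z: "z * (1 - of_real b * u) = u - of_real b" using nz by (simp add: z_def)
  have "1 + of_real b * z \<noteq> 0" using field_map_denom_nonzero[OF b, of z] \<open>norm z = 1\<close> by simp
  moreover have "z + of_real b = u * (1 + of_real b * z)" using z by (simp add: algebra_simps)
  ultimately have "field_map b z = u" by (simp add: field_map_def)
  then show thesis using that \<open>norm z = 1\<close> by blast
qed

text \<open>The fields of trees with root degree at most \<open>d\<close> form a dense set
  \<open>F\<close>. Hanging such a tree below a new root gives root degree \<open>1\<close> and
  applies \<open>z \<mapsto> cis t * field_map b z\<close>, a continuous map of the circle onto
  itself, so density survives.\<close>

lemma leaf_rooted_fields_dense: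
  assumes d: "2 \<le> d" and b: "0 < b" "b < 1" and lam: "cis t \<noteq> 1" "cis t \<noteq> - 1"
    and p: "norm p < 1" "cis t * field_map b p ^ d = p"
  shows "dense_in (leaf_rooted_fields d (cis t) b) unit_circle"
proof -
  define F where "F = (\<Union>k\<le>d. tree_fields d (cis t) b k)"
  have prod: "cis t * (\<Prod>i<k. field_map b (x i)) \<in> tree_fields d (cis t) b k"
    if "k \<le> d" "\<And>i. i < k \<Longrightarrow> x i \<in> F" for k x
    using that
  proof (induction k)
    case (Suc k)
    then have "cis t * (\<Prod>i<k. field_map b (x i)) \<in> tree_fields d (cis t) b k" by simp
    moreover obtain j where "x k \<in> tree_fields d (cis t) b j" using Suc.prems(2)[of k] by (auto simp: F_def)
    ultimately have "cis t * (\<Prod>i<k. field_map b (x i)) * field_map b (x k) \<in> tree_fields d (cis t) b (Suc k)"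
      using Suc.prems(1) by (intro tree_fields_join[OF b]) auto
    then show ?case by (simp add: mult.assoc)
  qed (simp add: tree_fields_single)
  have F_circle: "F \<subseteq> unit_circle"
    using norm_tree_fields[of "cis t"] by (auto simp: F_def unit_circle_def)
  interpret field_semigroup d b t F
  proof
    show "cis t * (\<Prod>i<k. field_map b (x i)) \<in> F" if "k \<le> d" "\<And>i. i < k \<Longrightarrow> x i \<in> F" for k x
      using prod[of k x] that unfolding F_def by blast
  qed (use d b lam F_circle in auto)
  define f where "f z = cis t * field_map b z" for z
  have "f ` F \<subseteq> tree_fields d (cis t) b 1"
    using prod[of 1 "\<lambda>_. z" for z] d by (auto simp: f_def)
  then have image: "f ` F \<subseteq> leaf_rooted_fields d (cis t) b" using tree_fields_leaf_rooted by blast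
  have "closure F \<subseteq> cball 0 1"
    using F_circle by (intro closure_minimal) (auto simp: unit_circle_def)
  then have "continuous_on (closure F) f" unfolding f_def
    by (intro continuous_intros continuous_on_subset[OF continuous_on_field_map[OF b]])
  then have closure: "f ` closure F \<subseteq> closure (leaf_rooted_fields d (cis t) b)"
    using image closure_subset by (intro image_closure_subset) auto
  have "unit_circle \<subseteq> f ` unit_circle"
  proof
    fix w assume "w \<in> unit_circle"
    then have "norm (w / cis t) = 1" by (simp add: unit_circle_def norm_divide)
    then obtain z where "norm z = 1" "field_map b z = w / cis t" using field_map_surj_circle[OF b] by blast
    then show "w \<in> f ` unit_circle" by (intro image_eqI[of _ _ z]) (auto simp: f_def unit_circle_def)
  qed
  then have "unit_circle \<subseteq> closure (leaf_rooted_fields d (cis t) b)"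
    using F_dense[OF p] closure by blast
  then show ?thesis using leaf_rooted_fields_subset by (simp add: dense_in_def)
qed

section \<open>Obstructions to density: real parameters and zero-free arcs\<close>

lemma implemented_field_real:
  assumes "simple_graph V E" "r \<in> V" "lam = 1 \<or> lam = -1" "implements_field V E r lam b \<xi>"
  shows "\<xi> = lam ^ card V"
proof -
  have "cnj lam = lam" using assms(3) by auto
  then have "cnj (Z_at V E r Minus lam b) = Z_at V E r Minus lam b"
    by (simp add: Z_at_def ising_weight_def)
  then show ?thesis
    using Z_at_Plus_eq_cnj[OF simple_graph_finite(1)[OF assms(1)] assms(1,2), of lam b] assms(3,4)
    by (auto simp: implements_field_def)
qed

text \<open>At a real parameter the restricted partition functions are real, so the spin-flip
  identity leaves only powers of \<open>lam\<close> as fields.\<close>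

lemma not_dense_real:
  assumes "lam = 1 \<or> lam = -1"
  shows "\<not> dense_in (leaf_rooted_fields d lam b) unit_circle"
proof
  assume "dense_in (leaf_rooted_fields d lam b) unit_circle"
  moreover have "leaf_rooted_fields d lam b \<subseteq> {1, -1}"
  proof
    fix \<xi> assume "\<xi> \<in> leaf_rooted_fields d lam b"
    then obtain V :: "nat set" and E r where G: "simple_graph V E" "max_degree V E \<le> d + 1" "r \<in> V"
      "degree E r \<le> d" "implements_field V E r lam b \<xi>"
      by (rule leaf_rooted_fieldsE)
    have "\<xi> = lam ^ card V" by (rule implemented_field_real[OF G(1,3) assms G(5)])
    then show "\<xi> \<in> {1, -1}" using assms by (cases "even (card V)") auto
  qed
  then have "closure (leaf_rooted_fields d lam b) \<subseteq> {1, -1}" by (intro closure_minimal) auto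
  ultimately have "unit_circle \<subseteq> {1, -1}" by (auto simp: dense_in_def)
  moreover have "\<i> \<in> unit_circle" by (simp add: unit_circle_def)
  ultimately show False by (auto simp: complex_eq_iff)
qed

text \<open>The last conclusion expresses that \<open>Z\<close> does not vanish after a pendant edge is attached at \<open>r\<close>.\<close>

lemma zero_free_field:
  fixes V :: "nat set"
  assumes b: "0 < b" "b < 1" and lam: "norm lam = 1"
    and zero_free: "\<And>(V :: nat set) E. simple_graph V E \<Longrightarrow> max_degree V E \<le> d + 1 \<Longrightarrow> Z V E lam b \<noteq> 0"
    and G: "simple_graph V E" "max_degree V E \<le> d + 1" "r \<in> V" "degree E r \<le> d"
  defines "\<xi> \<equiv> Z_at V E r Plus lam b / Z_at V E r Minus lam b"
  shows "implements_field V E r lam b \<xi>" "\<xi> \<noteq> - 1" "\<xi> * field_map b lam \<noteq> - 1"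
proof -
  let ?P = "Z_at V E r Plus lam b" and ?M = "Z_at V E r Minus lam b"
  have fin: "finite V" using simple_graph_finite(1)[OF G(1)] .
  have "Z V E lam b = ?P + ?M" using fin field_Z_split[OF fin] by (simp add: Z_eq Z_at_eq)
  then have sum: "?P + ?M \<noteq> 0" using zero_free[OF G(1,2)] by simp
  \<comment> \<open>By the spin-flip identity both parts vanish together, which would give a zero of
    \<open>Z\<close>.\<close>
  have nz: "?M \<noteq> 0" using sum Z_at_Plus_eq_cnj[OF fin G(1,3) lam, of b] by auto
  then show "implements_field V E r lam b \<xi>" by (simp add: implements_field_def \<xi>_def)
  show "\<xi> \<noteq> - 1" using sum nz by (auto simp: \<xi>_def divide_eq_eq add_eq_0_iff2)
  \<comment> \<open>Since the root has degree at most \<open>d\<close>, a pendant vertex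
    \<open>v\<close> can be added without exceeding the degree bound.\<close>
  obtain v where v: "v \<notin> V" using fin ex_new_if_finite infinite_UNIV_nat by blast
  let ?E = "insert {r, v} (E \<union> {})"
  have single: "simple_graph {v} {}" and disj: "V \<inter> {v} = {}" "v \<in> {v}" using v by (auto simp: simple_graph_def)
  have simple: "simple_graph (V \<union> {v}) ?E"
    using simple_graph_join[OF G(1) single disj(1) G(3) disj(2)] .
  have "degree ?E u \<le> d + 1" if "u \<in> V \<union> {v}" for u
  proof (cases "u \<in> V")
    case True
    have "degree E u \<le> d + 1" using G(2) True fin by (auto simp: max_degree_le_iff)
    then show ?thesis using degree_join[OF G(1) single disj(1) G(3) disj(2) True] G(4) by auto
  next
    case False
    then have "u = v" using that by simp
    then show ?thesis using degree_join'[OF G(1) single disj(1) G(3) disj(2) disj(2)]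
      by (simp add: degree_def)
  qed
  then have "max_degree (V \<union> {v}) ?E \<le> d + 1" using fin by (auto simp: max_degree_le_iff)
  then have "Z (V \<union> {v}) ?E lam b \<noteq> 0" by (intro zero_free simple)
  moreover have "Z (V \<union> {v}) ?E lam b = (1 + of_real b * lam) * (field_map b lam * ?P + ?M)"
  proof -
    have "Z (V \<union> {v}) ?E lam b = field_Z (insert v V) (insert {v, r} E) (\<lambda>_. lam) b"
      using fin by (simp add: Z_eq insert_commute)
    also have "\<dots> = (1 + of_real b * lam) * field_Z V E ((\<lambda>_. lam)(r := lam * field_map b lam)) b"
      using lam by (intro field_Z_leaf[OF b G(1) v G(3)]) simp
    also have "\<dots> = (1 + of_real b * lam) * (field_map b lam * ?P + ?M)"
      unfolding field_Z_split[OF fin, of _ _ b r] Z_at_eq[OF fin]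
      using field_Z_at_update[OF fin G(3), of E "\<lambda>_. lam" "field_map b lam" b] by simp
    finally show ?thesis .
  qed
  ultimately have "field_map b lam * ?P + ?M \<noteq> 0" by simp
  then show "\<xi> * field_map b lam \<noteq> - 1"
    using nz by (auto simp: \<xi>_def divide_eq_eq add_eq_0_iff2 mult.commute)
qed

lemma not_nonpos_Real_of_circle:
  fixes z :: complex
  assumes "norm z = 1" "z \<noteq> - 1"
  shows "z \<notin> \<real>\<^sub>\<le>\<^sub>0"
proof
  assume "z \<in> \<real>\<^sub>\<le>\<^sub>0"
  then have "Re z \<le> 0" "Im z = 0" by (auto simp: complex_nonpos_Reals_iff)
  then show False using assms by (auto simp: cmod_def complex_eq_iff)
qed

lemma continuous_on_Z_at: "continuous_on A (\<lambda>x. Z_at V E u s (cis (x * t)) b)"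
  unfolding Z_at_def ising_weight_def by (intro continuous_intros)

text \<open>Along the arc from \<open>1\<close> to \<open>cis t\<close> the angle \<open>Arg \<xi> + field_lift b t\<close> of a tree with a pendant
  edge starts at \<open>0\<close> and, in the absence of zeros, cannot cross \<open>\<plusminus>pi\<close>.\<close>

lemma zero_free_arc_field_bound:
  fixes V :: "nat set"
  assumes b: "0 < b" "b < 1"
    and zero_free: "\<And>(V :: nat set) E x. simple_graph V E \<Longrightarrow> max_degree V E \<le> d + 1 \<Longrightarrow>
      0 \<le> x \<Longrightarrow> x \<le> 1 \<Longrightarrow> Z V E (cis (x * t)) b \<noteq> 0"
    and G: "simple_graph V E" "max_degree V E \<le> d + 1" "r \<in> V" "degree E r \<le> d"
    and \<xi>: "implements_field V E r (cis t) b \<xi>"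
  shows "\<bar>Arg \<xi> + field_lift b t\<bar> < pi"
proof (rule ccontr)
  assume ge: "\<not> ?thesis"
  define R where "R x = Z_at V E r Plus (cis (x * t)) b / Z_at V E r Minus (cis (x * t)) b" for x
  have R: "implements_field V E r (cis (x * t)) b (R x)" "R x \<noteq> - 1" "R x * field_map b (cis (x * t)) \<noteq> - 1"
    if "0 \<le> x" "x \<le> 1" for x
    unfolding R_def using zero_free that by (intro zero_free_field[OF b _ _ G]; simp)+
  have norm_R: "norm (R x) = 1" if "0 \<le> x" "x \<le> 1" for x
    using norm_implemented_field[OF G(1,3) _ R(1)[OF that]] by simp
  define \<phi> where "\<phi> x = Arg (R x) + field_lift b (x * t)" for x
  have cis_\<phi>: "cis (\<phi> x) \<noteq> - 1" if "0 \<le> x" "x \<le> 1" for x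
  proof -
    have "cis (Arg (R x)) = R x" using norm_R[OF that] circle_cis_Arg by (simp add: unit_circle_def)
    then have "cis (\<phi> x) = R x * field_map b (cis (x * t))"
      by (simp add: \<phi>_def cis_mult[symmetric] cis_field_lift[OF b])
    then show ?thesis using R(3)[OF that] by simp
  qed
  have "continuous_on {0..1} R"
    unfolding R_def using R(1) by (intro continuous_intros continuous_on_Z_at) (auto simp: implements_field_def)
  \<comment> \<open>The field never meets \<open>-1\<close>, so its principal argument varies
    continuously along the arc.\<close>
  then have "continuous_on {0..1} (\<lambda>x. Arg (R x))"
    using norm_R R(2) by (intro continuous_intros not_nonpos_Real_of_circle) auto
  moreover have "continuous_on UNIV (field_lift b)"
    using DERIV_isCont[OF field_lift_deriv[OF b]] by (intro continuous_at_imp_continuous_on) blast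
  then have "continuous_on {0..1} (\<lambda>x. field_lift b (x * t))"
    by (rule continuous_on_compose2) (auto intro!: continuous_intros)
  ultimately have cont: "continuous_on {0..1} (\<lambda>x. \<bar>\<phi> x\<bar>)"
    unfolding \<phi>_def by (intro continuous_on_rabs continuous_on_add)
  have "R 0 = 1" using implemented_field_real[OF G(1,3), of 1 b "R 0"] R(1)[of 0] by simp
  then have "\<phi> 0 = 0" using b by (simp add: \<phi>_def)
  moreover have "R 1 = \<xi>" using \<xi> by (simp add: R_def implements_field_def)
  then have "pi \<le> \<bar>\<phi> 1\<bar>" using ge by (simp add: \<phi>_def)
  ultimately obtain x where "0 \<le> x" "x \<le> 1" "\<bar>\<phi> x\<bar> = pi"
    using IVT'[of "\<lambda>x. \<bar>\<phi> x\<bar>" 0 pi 1] cont by auto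
  moreover from this have "\<phi> x = pi \<or> \<phi> x = - pi" by auto
  then have "cis (\<phi> x) = - 1" by (auto simp: complex_eq_iff)
  ultimately show False using cis_\<phi> by blast
qed

lemma not_dense_on_zero_free_arc:
  assumes d: "2 \<le> d" and b: "0 < b" "b < 1" and t: "t \<noteq> 0"
    and zero_free: "\<And>(V :: nat set) E x. simple_graph V E \<Longrightarrow> max_degree V E \<le> d + 1 \<Longrightarrow>
      0 \<le> x \<Longrightarrow> x \<le> 1 \<Longrightarrow> Z V E (cis (x * t)) b \<noteq> 0"
  shows "\<not> dense_in (leaf_rooted_fields d (cis t) b) unit_circle"
proof
  assume dense: "dense_in (leaf_rooted_fields d (cis t) b) unit_circle"
  define H where "H = field_lift b \<bar>t\<bar>"
  have H: "0 < H" using field_lift_strict_mono[OF b, of 0 "\<bar>t\<bar>"] b t by (simp add: H_def)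
  have Ht: "field_lift b t = sgn t * H"
    using field_lift_minus[OF b, of t] by (cases "t \<ge> 0") (auto simp: H_def sgn_if t)
  define \<delta> where "\<delta> = min H 1 / 2"
  have \<delta>: "0 < \<delta>" "\<delta> < H" "\<delta> < pi" using H pi_gt3 by (auto simp: \<delta>_def)
  \<comment> \<open>A target at distance \<open>\<delta> < H\<close> from \<open>-1\<close>, on the
    side given by the sign of \<open>t\<close>: a field whose argument is within
    \<open>H - \<delta>\<close> of \<open>\<psi>\<close> would be turned beyond \<open>pi\<close> by
    the pendant edge.\<close>
  define \<psi> where "\<psi> = sgn t * (pi - \<delta>)"
  have \<psi>: "\<bar>\<psi>\<bar> < pi" using \<delta> t by (auto simp: \<psi>_def sgn_if)
  then have Arg_\<psi>: "Arg (cis \<psi>) = \<psi>" by (intro Arg_cis) auto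
  have "cis \<psi> \<noteq> - 1" using one_plus_cis_nonzero[OF \<psi>] by auto
  then have "isCont Arg (cis \<psi>)" by (intro continuous_at_Arg not_nonpos_Real_of_circle) auto
  then obtain \<epsilon> where \<epsilon>: "0 < \<epsilon>" "\<And>z. dist z (cis \<psi>) < \<epsilon> \<Longrightarrow> dist (Arg z) \<psi> < H - \<delta>"
    using \<delta> unfolding continuous_at_eps_delta Arg_\<psi> by (metis diff_gt_0_iff_gt)
  have "cis \<psi> \<in> closure (leaf_rooted_fields d (cis t) b)"
    using dense by (auto simp: dense_in_def unit_circle_def)
  then obtain \<xi> where \<xi>: "\<xi> \<in> leaf_rooted_fields d (cis t) b" "dist \<xi> (cis \<psi>) < \<epsilon>"
    using \<epsilon>(1) unfolding closure_approachable by blast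
  obtain V :: "nat set" and E r where G: "simple_graph V E" "max_degree V E \<le> d + 1" "r \<in> V" "degree E r \<le> d"
    "implements_field V E r (cis t) b \<xi>"
    using \<xi>(1) by (rule leaf_rooted_fieldsE)
  have "\<bar>Arg \<xi> + sgn t * H\<bar> < pi"
    unfolding Ht[symmetric] 
    by (rule zero_free_arc_field_bound[OF b, where d = d and V = V and E = E and r = r])
       (use zero_free G in blast)+
  moreover have "\<bar>Arg \<xi> - sgn t * (pi - \<delta>)\<bar> < H - \<delta>"
    using \<epsilon>(2)[OF \<xi>(2)] by (simp add: dist_real_def \<psi>_def)
  ultimately show False using t by (auto simp: sgn_if split: if_splits)
qed

subsection \<open>Location of the dense parameters\<close>

lemma cis_in_circle_arc_iff:
  assumes "- pi < t" "t \<le> pi" "\<theta> < pi"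
  shows "cis t \<in> circle_arc \<theta> \<longleftrightarrow> \<bar>t\<bar> < \<theta>"
proof
  assume "cis t \<in> circle_arc \<theta>"
  then obtain t' where t': "cis t = cis t'" "- \<theta> < t'" "t' < \<theta>" by (auto simp: circle_arc_def)
  have "t = Arg (cis t)" by (rule Arg_cis[symmetric]) (use assms in auto)
  also have "\<dots> = Arg (cis t')" by (rule arg_cong[OF t'(1)])
  also have "\<dots> = t'" by (rule Arg_cis) (use assms t'(2,3) in auto)
  finally have "t = t'" .
  then show "\<bar>t\<bar> < \<theta>" using t'(2,3) by (simp add: abs_less_iff)
qed (auto simp: circle_arc_def abs_less_iff)

text \<open>Rational points of the circle come from rational tangents of the half angle.\<close>

lemma rational_circle_angle_between:
  assumes "- pi \<le> lo" "lo < hi" "hi \<le> pi"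
  obtains t where "lo < t" "t < hi" "cis t \<in> rational_circle"
proof -
  \<comment> \<open>Points strictly inside the interval keep the half angles strictly between
    \<open>- pi / 2\<close> and \<open>pi / 2\<close>, even when \<open>lo\<close> or
    \<open>hi\<close> is at the boundary.\<close>
  define l h where "l = (2 * lo + hi) / 3" and "h = (lo + 2 * hi) / 3"
  have lh: "lo < l" "l < h" "h < hi" using assms(2) by (simp_all add: l_def h_def)
  have "tan (l / 2) < tan (h / 2)" using lh assms by (intro tan_monotone) auto
  then obtain q where q: "q \<in> \<rat>" "tan (l / 2) < q" "q < tan (h / 2)" using Rats_dense_in_real by blast
  define t where "t = 2 * arctan q"
  have "arctan (tan (l / 2)) = l / 2" "arctan (tan (h / 2)) = h / 2"
    by (intro arctan_tan; use lh assms in simp)+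
  then have "l / 2 < arctan q" "arctan q < h / 2"
    using arctan_monotone[OF q(2)] arctan_monotone[OF q(3)] by auto
  then have "lo < t" "t < hi" using lh by (auto simp: t_def)
  moreover have "cos t = (1 - q\<^sup>2) / (1 + q\<^sup>2)" "sin t = 2 * q / (1 + q\<^sup>2)"
    using cos_tan_half[of "arctan q"] sin_tan_half[of "arctan q"] by (simp_all add: t_def tan_arctan)
  then have "cis t \<in> rational_circle" using q(1) by (auto simp: rational_circle_def unit_circle_def)
  ultimately show thesis using that by blast
qed

lemma dense_field_params_subset:
  "dense_field_params d b \<subseteq> rational_circle - {1, -1}"
  using not_dense_real[of _ d b] by (auto simp: dense_field_params_def)

lemma dense_field_params_small_b:
  assumes d: "2 \<le> d" and b: "0 < b" "b \<le> (real d - 1) / (real d + 1)"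
  shows "dense_field_params d b = rational_circle - {1, -1}"
proof
  have "(real d - 1) / (real d + 1) < 1" by simp
  then have b1: "b < 1" using b by linarith
  show "rational_circle - {1, -1} \<subseteq> dense_field_params d b"
  proof
    fix lam assume lam: "lam \<in> rational_circle - {1, -1}"
    then have eq: "cis (Arg lam) = lam" by (intro circle_cis_Arg) (auto simp: rational_circle_def)
    then obtain p where "norm p < 1" "cis (Arg lam) * field_map b p ^ d = p"
      using fixed_point_in_disc_of_small_b[OF b, of "Arg lam"] lam by auto
    then have "dense_in (leaf_rooted_fields d lam b) unit_circle"
      using leaf_rooted_fields_dense[OF d b(1) b1, of "Arg lam" p] lam unfolding eq by auto
    then show "lam \<in> dense_field_params d b" using lam by (simp add: dense_field_params_def)
  qed
qed (rule dense_field_params_subset)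

text \<open>If \<open>lam\<close> were in the arc, the entire path \<open>cis (x * t)\<close> from
  \<open>1\<close> to \<open>lam\<close> would be zero-free.\<close>

lemma dense_field_params_outside_arc:
  assumes d: "2 \<le> d" and b: "0 < b" "b < 1" and \<theta>: "lee_yang_angle (d + 1) b \<theta>"
  shows "dense_field_params d b \<subseteq> unit_circle - circle_arc \<theta>"
proof
  fix lam assume lam: "lam \<in> dense_field_params d b"
  then have circle: "lam \<in> unit_circle" and dense: "dense_in (leaf_rooted_fields d lam b) unit_circle"
    by (auto simp: dense_field_params_def rational_circle_def)
  have "lam \<notin> circle_arc \<theta>"
  proof
    assume "lam \<in> circle_arc \<theta>"
    then obtain t where t: "lam = cis t" "\<bar>t\<bar> < \<theta>" by (auto simp: circle_arc_def)
    have "lam \<noteq> 1" using lam dense_field_params_subset by blast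
    then have "t \<noteq> 0" using t by auto
    have "Z V E (cis (x * t)) b \<noteq> 0"
      if G: "simple_graph V E" "max_degree V E \<le> d + 1" "0 \<le> x" "x \<le> 1" for V :: "nat set" and E x
    proof -
      have "x * \<bar>t\<bar> \<le> 1 * \<bar>t\<bar>" using that by (intro mult_right_mono) auto
      then have "\<bar>x * t\<bar> < \<theta>" using t(2) that by (simp add: abs_mult)
      then have "cis (x * t) \<in> circle_arc \<theta>" by (auto simp: circle_arc_def abs_less_iff)
      then show ?thesis using \<theta> G unfolding lee_yang_angle_def by blast
    qed
    then show False using not_dense_on_zero_free_arc[OF d b \<open>t \<noteq> 0\<close>] dense t(1) by blast
  qed
  then show "lam \<in> unit_circle - circle_arc \<theta>" using circle by simp
qed

text \<open>A neutral fixed point at \<open>cis t\<close> would exclude tree zeros on the whole arc between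
  \<open>cis (- t)\<close> and \<open>cis t\<close>, but there are such zeros near \<open>cis ((\<theta> + \<bar>t\<bar>) / 2)\<close>.\<close>

lemma fixed_point_in_disc_outside_arc:
  assumes d: "2 \<le> d" and b: "0 < b" "b < 1" and \<theta>: "lee_yang_angle (d + 1) b \<theta>"
    and t: "\<theta> < \<bar>t\<bar>" "\<bar>t\<bar> < pi"
  obtains p where "norm p < 1" "cis t * field_map b p ^ d = p"
proof (rule ccontr)
  assume "\<not> thesis"
  then have "\<not> (\<exists>p. norm p < 1 \<and> cis t * field_map b p ^ d = p)" using that by blast
  then obtain p where p: "norm p = 1" "cis t * field_map b p ^ d = p"
    "d * (1 - b\<^sup>2) \<le> (norm (1 + of_real b * p))\<^sup>2"
    using fixed_point_dichotomy[OF b, of t d] by blast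
  have "- pi < t" "t \<le> pi" using t by auto
  then obtain x where x: "0 \<le> x" "\<bar>t\<bar> + d * field_lift b x \<le> x" "x + field_lift b x < pi"
    using circle_neutral_fixed_point[OF b d _ _ p] by blast
  \<comment> \<open>The midpoint leaves room on both sides: it is outside the arc, and the nearby
    zero still has argument at most \<open>\<bar>t\<bar>\<close> in absolute value.\<close>
  define t1 where "t1 = (\<theta> + \<bar>t\<bar>) / 2"
  have \<theta>_bounds: "0 < \<theta>" "\<theta> < pi" using \<theta> by (auto simp: lee_yang_angle_def)
  then have t1: "\<theta> < t1" "t1 < \<bar>t\<bar>" "0 < t1" using t by (auto simp: t1_def)
  have "cis t1 \<in> unit_circle - circle_arc \<theta>"
    using cis_in_circle_arc_iff[of t1 \<theta>] t1 t \<theta>_bounds by (simp add: unit_circle_def)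
  have Arg_t1: "Arg (cis t1) = t1" using t1 t by (intro Arg_cis) auto
  have "\<bar>t1\<bar> < pi" using t1 t by auto
  then have "cis t1 \<noteq> - 1" using one_plus_cis_nonzero[of t1] by auto
  then have "isCont Arg (cis t1)" by (intro continuous_at_Arg not_nonpos_Real_of_circle) auto
  then obtain \<epsilon> where \<epsilon>: "0 < \<epsilon>" "\<And>z. dist z (cis t1) < \<epsilon> \<Longrightarrow> dist (Arg z) t1 < \<bar>t\<bar> - t1"
    using t1(2) unfolding continuous_at_eps_delta Arg_t1 by (metis diff_gt_0_iff_gt)
  obtain lam V E where lam: "lam \<in> unit_circle" "dist lam (cis t1) < \<epsilon>"
    and T: "tree (V :: nat set) E" "max_degree V E = d + 1" "Z V E lam b = 0"
    using \<theta> \<open>cis t1 \<in> unit_circle - circle_arc \<theta>\<close> \<epsilon>(1) unfolding lee_yang_angle_def by blast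
  have "\<bar>Arg lam - t1\<bar> < \<bar>t\<bar> - t1" using \<epsilon>(2)[OF lam(2)] by (simp add: dist_real_def)
  then have "\<bar>Arg lam\<bar> \<le> \<bar>t\<bar>" using t1(3) by linarith
  then have "Z V E (cis (Arg lam)) b \<noteq> 0"
    using T(1,2) by (intro tree_Z_nonzero[OF b x]) (auto simp: tree_def)
  then show False using T(3) circle_cis_Arg[OF lam(1)] by simp
qed

lemma dense_field_params_dense:
  assumes d: "2 \<le> d" and b: "0 < b" "b < 1" and \<theta>: "lee_yang_angle (d + 1) b \<theta>"
  shows "unit_circle - circle_arc \<theta> \<subseteq> closure (dense_field_params d b)"
proof
  fix lam assume lam: "lam \<in> unit_circle - circle_arc \<theta>"
  have \<theta>_bounds: "0 < \<theta>" "\<theta> < pi" using \<theta> by (auto simp: lee_yang_angle_def)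
  define t0 where "t0 = Arg lam"
  have t0: "- pi < t0" "t0 \<le> pi" "cis t0 = lam"
    using Arg_bounded[of lam] circle_cis_Arg lam by (auto simp: t0_def)
  then have t0_ge: "\<theta> \<le> \<bar>t0\<bar>" using cis_in_circle_arc_iff[of t0 \<theta>] lam \<theta>_bounds by auto
  show "lam \<in> closure (dense_field_params d b)"
    unfolding closure_approachable
  proof (intro allI impI)
    fix \<epsilon> :: real assume \<epsilon>: "0 < \<epsilon>"
    \<comment> \<open>When \<open>t0\<close> is an end of the complementary arc, the interval
      extends to one side only, so that its angles stay strictly between \<open>\<theta>\<close> and
      \<open>pi\<close> in absolute value.\<close>
    obtain lo hi where lohi: "- pi \<le> lo" "lo < hi" "hi \<le> pi"
      "\<And>t. lo < t \<Longrightarrow> t < hi \<Longrightarrow> \<theta> < \<bar>t\<bar> \<and> \<bar>t\<bar> < pi \<and> \<bar>t - t0\<bar> < \<epsilon>"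
    proof (cases "0 \<le> t0")
      case True
      then show ?thesis using t0 t0_ge \<epsilon> \<theta>_bounds
        by (intro that[of "max \<theta> (t0 - \<epsilon>)" "min pi (t0 + \<epsilon>)"]) auto
    next
      case False
      then show ?thesis using t0 t0_ge \<epsilon> \<theta>_bounds
        by (intro that[of "max (- pi) (t0 - \<epsilon>)" "min (- \<theta>) (t0 + \<epsilon>)"]) auto
    qed
    obtain t where "lo < t" "t < hi" and rat: "cis t \<in> rational_circle"
      using rational_circle_angle_between[OF lohi(1-3)] by blast
    then have t: "\<theta> < \<bar>t\<bar>" "\<bar>t\<bar> < pi" "\<bar>t - t0\<bar> < \<epsilon>" using lohi(4) by blast+
    obtain p where p: "norm p < 1" "cis t * field_map b p ^ d = p"
      using fixed_point_in_disc_outside_arc[OF d b \<theta> t(1,2)] by blast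
    have "cis t \<noteq> - 1" using one_plus_cis_nonzero[OF t(2)] by auto
    moreover have "cis t \<noteq> 1"
    proof
      assume "cis t = 1"
      then have "Arg (cis t) = 0" by simp
      moreover have "Arg (cis t) = t" using t(2) by (intro Arg_cis) auto
      ultimately show False using t(1) \<theta>_bounds by simp
    qed
    ultimately have "cis t \<in> dense_field_params d b"
      using leaf_rooted_fields_dense[OF d b _ _ p] rat by (simp add: dense_field_params_def)
    moreover have "dist (cis t) lam < \<epsilon>" using dist_cis_le[of t t0] t(3) t0(3) by simp
    ultimately show "\<exists>z\<in>dense_field_params d b. dist z lam < \<epsilon>" by blast
  qed
qed

theorem theorem6:
  fixes d :: nat
  assumes "d \<ge> 2"
  shows "(\<forall>b::real. b \<in> \<rat> \<and> 0 < b \<and> b \<le> (real d - 1) / (real d + 1) \<longrightarrow>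
            dense_field_params d b = rational_circle - {1, -1}) \<and>
         (\<forall>b \<theta>::real. b \<in> \<rat> \<and> (real d - 1) / (real d + 1) < b \<and> b < 1 \<and>
            lee_yang_angle (d + 1) b \<theta> \<longrightarrow>
            dense_in (dense_field_params d b) (unit_circle - circle_arc \<theta>))"
proof (intro conjI allI impI)
  fix b :: real
  assume "b \<in> \<rat> \<and> 0 < b \<and> b \<le> (real d - 1) / (real d + 1)"
  then show "dense_field_params d b = rational_circle - {1, -1}"
    using dense_field_params_small_b[OF assms] by blast
next
  fix b \<theta> :: real
  assume *: "b \<in> \<rat> \<and> (real d - 1) / (real d + 1) < b \<and> b < 1 \<and> lee_yang_angle (d + 1) b \<theta>"
  have "0 < (real d - 1) / (real d + 1)" using assms by simp
  with * have b: "0 < b" "b < 1" by auto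
  show "dense_in (dense_field_params d b) (unit_circle - circle_arc \<theta>)"
    unfolding dense_in_def
    using dense_field_params_outside_arc[OF assms b] dense_field_params_dense[OF assms b] * by blast
qed

end
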